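(* Let $$C=\{(\lambda_1,\lambda_2,\lambda_3)\in\mathbb{R}^3\mid \lambda_1c_1^3(X)+\lambda_2c_1(X)c_2(X)+\lambda_3c_3(X)\ge 0 \text{ for every SCI threefold } X \text{ with } K_X \text{ ample}\}.$$ Then $C$ is a rational convex cone whose edges are exactly (the rays spanned by) the vectors $$(-k_0,-b_0,1),\qquad (k_m,b_m,-1)\ \ (m\ge 1),\qquad (k_\infty,b_\infty,-1),$$ where $(k_0,b_0)=(-\frac{242}{93},\frac{515}{93})$, $(k_1,b_1)=(-42,8)$, $(k_2,b_2)=(-22,6)$, $(k_3,b_3)=(-14,5)$, $(k_4,b_4)=(-\frac92,\frac{41}{12})$, $(k_5,b_5)=(-\frac{13}{4},3)$, for every integer $m\ge 6$ $$k_m=\frac{-28m+m^2+4m^3-m^4}{(m-4)(m-3)(3m^2-5m-20)},\qquad b_m=\frac{-120+254m+3m^2-50m^3+9m^4}{3(m-4)(m-3)(3m^2-5m-20)},$$ and $(k_\infty,b_\infty)=(-\frac13,1)$.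
   Context: Varieties are over $\mathbb{C}$. An SCI threefold is a smooth complete intersection threefold $X$ in some projective space $\mathbb{P}^{n+3}$ ($n\geq 1$), cut out by $n$ hypersurfaces. $c_i(X)=c_i(T_X)$, and $c_1^3(X)$, $c_1(X)c_2(X)$, $c_3(X)$ denote the Chern numbers. An edge of a convex cone is a one-dimensional face; the cone is rational in the sense that its edges are spanned by rational vectors. Explicitly, if $X\subset\mathbb{P}^{n+3}$ is a complete intersection of hypersurfaces of degrees $d_1+1,\dots,d_n+1$ with $d_i\ge1$, then with $s_j=\sum_i d_i^j$ and $h$ the hyperplane class, $c_1(T_X)=(4-s_1)h$, $c_2(T_X)=\left(\frac{s_1^2+s_2}{2}-3(s_1-2)\right)h^2$, $c_3(T_X)=\left(-\frac{s_1^3+3s_1s_2+2s_3}{6}+(s_1^2+s_2)-3s_1+4\right)h^3$, and $K_X$ is ample if and only if $s_1\ge 5$. The numbers $k_m,b_m$ are the slopes and intercepts of lines $y=k_mx+b_m$ in the plane of Chern ratios $(x,y)=(\frac{c_1^3}{c_1c_2},\frac{c_3}{c_1c_2})$: for $m\ge1$ the line through $p_m$ and $p_{m+1}$, for $m=0$ the line through $p_1$ and $p_\infty$, and for $m=\infty$ the limit of the lines through $p_m,p_{m+1}$; here $p_1=(\frac1{16},\frac{43}8)$, $p_2=(\frac1{10},\frac{19}5)$, $p_3=(\frac18,\frac{13}4)$, $p_4=(\frac16,\frac83)$, $p_5=(\frac13,\frac{23}{12})$, $p_n=\left(\frac{2(n-4)^2}{n^2-5n+12},\frac{n^3-3n^2+14n-24}{3(n-4)(n^2-5n+12)}\right)$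 for $n\ge 6$, and $p_\infty=(2,\frac13)$. *)

theory Defs
  imports
    "HOL-Analysis.Analysis"
    "HOL-Computational_Algebra.Formal_Power_Series"
begin

section \<open>Forms and projective space\<close>

text \<open>
  Homogeneous coordinates on the projective space of dimension N - 1 are sequences supported on the
  indices below N; projective sets are represented by their punctured affine cones, that is, by the
  set of all nonzero homogeneous coordinate vectors of their points.  Over the complex numbers a
  form can be identified with the function it defines.
\<close>

definition coord_space :: "nat \<Rightarrow> (nat \<Rightarrow> complex) set" where
  "coord_space N = {x. \<forall>j\<ge>N. x j = 0}"

definition exponents :: "nat \<Rightarrow> nat \<Rightarrow> (nat \<Rightarrow> nat) set" where
  "exponents N e = {\<alpha>. (\<forall>j\<ge>N. \<alpha> j = 0) \<and> (\<Sum>j<N. \<alpha> j) = e}"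

definition is_form :: "nat \<Rightarrow> nat \<Rightarrow> ((nat \<Rightarrow> complex) \<Rightarrow> complex) \<Rightarrow> bool" where
  "is_form N e f \<longleftrightarrow>
     (\<exists>a. \<forall>x. f x = (\<Sum>\<alpha>\<in>exponents N e. a \<alpha> * (\<Prod>j<N. x j ^ \<alpha> j)))"

definition partial :: "nat \<Rightarrow> ((nat \<Rightarrow> complex) \<Rightarrow> complex) \<Rightarrow> (nat \<Rightarrow> complex) \<Rightarrow> complex" where
  "partial j f x = deriv (\<lambda>t. f (x(j := t))) (x j)"

definition differential ::
    "nat \<Rightarrow> ((nat \<Rightarrow> complex) \<Rightarrow> complex) \<Rightarrow> (nat \<Rightarrow> complex) \<Rightarrow> (nat \<Rightarrow> complex) \<Rightarrow> complex" where
  "differential N f x v = (\<Sum>j<N. partial j f x * v j)"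

lemma finite_exponents: "finite (exponents N e)"
proof (rule finite_subset)
  show "exponents N e \<subseteq> {\<alpha>. \<forall>j. (j \<in> {..<N} \<longrightarrow> \<alpha> j \<in> {..e}) \<and> (j \<notin> {..<N} \<longrightarrow> \<alpha> j = 0)}"
    by (auto simp: exponents_def intro!: member_le_sum)
  show "finite {\<alpha>. \<forall>j. (j \<in> {..<N} \<longrightarrow> \<alpha> j \<in> {..e}) \<and> (j \<notin> {..<N} \<longrightarrow> \<alpha> j = (0::nat))}"
    by (rule finite_set_of_finite_funs) auto
qed


section \<open>Smooth complete intersection threefolds\<close>

text \<open>
  \<open>ci_codim X = n\<close> hypersurfaces in the projective space of dimension n + 3, the i-th one (i < n)
  being the zero locus of the form \<open>ci_form X i\<close> of degree \<open>ci_deg X i\<close>.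
\<close>

record complete_intersection =
  ci_codim :: nat
  ci_deg :: "nat \<Rightarrow> nat"
  ci_form :: "nat \<Rightarrow> (nat \<Rightarrow> complex) \<Rightarrow> complex"

definition ncoords :: "complete_intersection \<Rightarrow> nat" where
  "ncoords X = ci_codim X + 4"

definition ci_points :: "complete_intersection \<Rightarrow> (nat \<Rightarrow> complex) set" where
  "ci_points X = {x \<in> coord_space (ncoords X). x \<noteq> (\<lambda>_. 0) \<and> (\<forall>i<ci_codim X. ci_form X i x = 0)}"

text \<open>
  The tangent space of the affine cone over X at x; the tangent space of X at the point [x] is its
  quotient by the line spanned by x.
\<close>

definition cone_tangent :: "complete_intersection \<Rightarrow> (nat \<Rightarrow> complex) \<Rightarrow> (nat \<Rightarrow> complex) set" where
  "cone_tangent X x = {v \<in> coord_space (ncoords X).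
     \<forall>i<ci_codim X. differential (ncoords X) (ci_form X i) x v = 0}"

text \<open>
  Smoothness of dimension 3 of the scheme cut out by the forms is the Jacobian criterion: the
  gradients of the n forms are linearly independent at every point.  Hyperplanes are allowed
  among the hypersurfaces; they only replace the ambient space by a smaller one.
\<close>

definition sci_threefold :: "complete_intersection \<Rightarrow> bool" where
  "sci_threefold X \<longleftrightarrow>
     ci_codim X \<ge> 1 \<and>
     (\<forall>i<ci_codim X. ci_deg X i \<ge> 1 \<and> is_form (ncoords X) (ci_deg X i) (ci_form X i)) \<and>
     ci_points X \<noteq> {} \<and>
     (\<forall>x\<in>ci_points X. \<forall>a.
        (\<forall>j<ncoords X. (\<Sum>i<ci_codim X. a i * partial j (ci_form X i) x) = 0)
        \<longrightarrow> (\<forall>i<ci_codim X. a i = 0))"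


section \<open>Ampleness of the canonical bundle\<close>

text \<open>
  Global sections of the line bundle \<open>O\<^sub>X(l)\<close>: complete intersections of positive dimension are
  projectively normal, so every section is the restriction of a form of degree l, and there is no
  nonzero section for l < 0.
\<close>

definition twist_sections :: "complete_intersection \<Rightarrow> int \<Rightarrow> ((nat \<Rightarrow> complex) \<Rightarrow> complex) set" where
  "twist_sections X l = {f. 0 \<le> l \<and> is_form (ncoords X) (nat l) f}"

text \<open>
  The sections of \<open>O\<^sub>X(l)\<close> define a closed immersion into projective space, i.e. they have no base
  points and separate points and tangent vectors.
\<close>

definition very_ample_twist :: "complete_intersection \<Rightarrow> int \<Rightarrow> bool" where
  "very_ample_twist X l \<longleftrightarrow>
     (\<forall>x\<in>ci_points X. \<exists>f\<in>twist_sections X l. f x \<noteq> 0) \<and>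
     (\<forall>x\<in>ci_points X. \<forall>y\<in>ci_points X. (\<nexists>c. y = (\<lambda>j. c * x j)) \<longrightarrow>
        (\<exists>f\<in>twist_sections X l. f x = 0 \<and> f y \<noteq> 0)) \<and>
     (\<forall>x\<in>ci_points X. \<forall>v\<in>cone_tangent X x. (\<nexists>c. v = (\<lambda>j. c * x j)) \<longrightarrow>
        (\<exists>f\<in>twist_sections X l. f x = 0 \<and> differential (ncoords X) f x v \<noteq> 0))"

definition ample_twist :: "complete_intersection \<Rightarrow> int \<Rightarrow> bool" where
  "ample_twist X l \<longleftrightarrow> (\<exists>m>0. very_ample_twist X (m * l))"

text \<open>Adjunction: the canonical bundle of X is \<open>O\<^sub>X(canonical_twist X)\<close>.\<close>

definition canonical_twist :: "complete_intersection \<Rightarrow> int" where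
  "canonical_twist X = (\<Sum>i<ci_codim X. int (ci_deg X i)) - int (ncoords X)"

definition canonical_ample :: "complete_intersection \<Rightarrow> bool" where
  "canonical_ample X \<longleftrightarrow> ample_twist X (canonical_twist X)"


section \<open>Chern numbers\<close>

text \<open>
  In terms of the hyperplane class h, the Euler sequence and the normal bundle sequence give, for
  forms of degrees \<open>e\<^sub>i\<close>, the total Chern class
  \<open>c(T\<^sub>X) = (1 + h)\<^sup>n\<^sup>+\<^sup>4 / (\<Prod>i<n. 1 + e\<^sub>i h)\<close>, taken modulo the fourth power of h.  The class \<open>c\<^sub>k\<close> is
  its coefficient at the k-th power of h.  The third power of h is the class of degree
  \<open>\<Prod>i<n. e\<^sub>i\<close> (Bezout).
\<close>

definition total_chern :: "complete_intersection \<Rightarrow> real fps" where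
  "total_chern X =
     (1 + fps_X) ^ ncoords X *
     inverse (\<Prod>i<ci_codim X. 1 + fps_const (real (ci_deg X i)) * fps_X)"

definition chern_coeff :: "complete_intersection \<Rightarrow> nat \<Rightarrow> real" where
  "chern_coeff X k = fps_nth (total_chern X) k"

definition hyperplane_degree :: "complete_intersection \<Rightarrow> real" where
  "hyperplane_degree X = (\<Prod>i<ci_codim X. real (ci_deg X i))"

definition c1_cubed :: "complete_intersection \<Rightarrow> real" where
  "c1_cubed X = chern_coeff X 1 ^ 3 * hyperplane_degree X"

definition c1_c2 :: "complete_intersection \<Rightarrow> real" where
  "c1_c2 X = chern_coeff X 1 * chern_coeff X 2 * hyperplane_degree X"

definition c3 :: "complete_intersection \<Rightarrow> real" where
  "c3 X = chern_coeff X 3 * hyperplane_degree X"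

definition excess_power_sum :: "complete_intersection \<Rightarrow> nat \<Rightarrow> real" where
  "excess_power_sum X j = (\<Sum>i<ci_codim X. (real (ci_deg X i) - 1) ^ j)"

lemma total_chern_coeffs:
  fixes e :: "nat \<Rightarrow> nat" and n :: nat
  defines "s j \<equiv> (\<Sum>i<n. (real (e i) - 1) ^ j)"
  defines "P \<equiv> (1 + fps_X) ^ (n + 4) * inverse (\<Prod>i<n. 1 + fps_const (real (e i)) * fps_X)"
  shows "fps_nth P 0 = 1 \<and> fps_nth P 1 = 4 - s 1 \<and>
         fps_nth P 2 = ((s 1)^2 + s 2) / 2 - 3 * (s 1 - 2) \<and>
         fps_nth P 3 = - ((s 1)^3 + 3 * s 1 * s 2 + 2 * s 3) / 6 + ((s 1)^2 + s 2) - 3 * s 1 + 4"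
  unfolding s_def P_def
proof (induction n)
  case 0
  have "fps_nth (f * (1 + fps_X)) k = fps_nth f k + (if k = 0 then 0 else fps_nth f (k - 1))"
    for f :: "real fps" and k
    by (simp add: distrib_left)
  then show ?case
    by (simp add: power_numeral_even power_numeral_odd eval_nat_numeral mult.assoc[symmetric])
next
  case (Suc n)
  define Q where "Q = (\<Prod>i<n. 1 + fps_const (real (e i)) * fps_X)"
  define L where "L = 1 + fps_const (real (e n)) * fps_X"
  define A where "A = (1 + fps_X) ^ (n + 4) * inverse Q"
  define B where "B = (1 + fps_X) ^ (Suc n + 4) * inverse (Q * L)"
  have L0: "fps_nth L 0 \<noteq> 0" by (simp add: L_def)
  have inv: "inverse (Q * L) * L = inverse Q"
    using inverse_mult_eq_1[OF L0] by (simp add: fps_inverse_mult mult.assoc)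
  have pow: "(1 + fps_X :: real fps) ^ (Suc n + 4) = (1 + fps_X) ^ (n + 4) * (1 + fps_X)"
    by (simp only: add_Suc power_Suc2)
  have "B * L = (1 + fps_X) ^ (Suc n + 4) * (inverse (Q * L) * L)"
    by (simp only: B_def mult.assoc)
  also have "\<dots> = A * (1 + fps_X)"
    unfolding inv pow A_def by (simp only: mult_ac)
  finally have "B * L = A * (1 + fps_X)" .
  then have rec: "B + fps_const (real (e n)) * (B * fps_X) = A + A * fps_X"
    by (simp add: L_def algebra_simps)
  have step: "fps_nth B (Suc k) + real (e n) * fps_nth B k = fps_nth A (Suc k) + fps_nth A k" for k
    using arg_cong[OF rec, of "\<lambda>f. fps_nth f (Suc k)"] by simp
  have B0: "fps_nth B 0 = fps_nth A 0"
    using arg_cong[OF rec, of "\<lambda>f. fps_nth f 0"] by simp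
  have BB: "(1 + fps_X) ^ (Suc n + 4) * inverse (\<Prod>i<Suc n. 1 + fps_const (real (e i)) * fps_X) = B"
    by (simp add: B_def Q_def L_def)
  define d where "d = real (e n) - 1"
  define s1 where "s1 = (\<Sum>i<n. (real (e i) - 1) ^ 1)"
  define s2 where "s2 = (\<Sum>i<n. (real (e i) - 1) ^ 2)"
  define s3 where "s3 = (\<Sum>i<n. (real (e i) - 1) ^ 3)"
  have IH: "fps_nth A 0 = 1" "fps_nth A 1 = 4 - s1"
     "fps_nth A 2 = (s1^2 + s2) / 2 - 3 * (s1 - 2)"
     "fps_nth A 3 = - (s1^3 + 3 * s1 * s2 + 2 * s3) / 6 + (s1^2 + s2) - 3 * s1 + 4"
    using Suc.IH by (simp_all add: A_def Q_def s1_def s2_def s3_def)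
  have en: "real (e n) = d + 1" by (simp add: d_def)
  have B1: "fps_nth B 1 = 4 - (s1 + d)"
    using step[of 0] B0 IH by (simp add: en)
  have B2: "fps_nth B 2 = ((s1 + d)^2 + (s2 + d^2)) / 2 - 3 * (s1 + d - 2)"
  proof -
    have "fps_nth B 2 = fps_nth A 2 + fps_nth A 1 - (d + 1) * fps_nth B 1"
      using step[of 1] by (simp add: en numeral_2_eq_2)
    then show ?thesis
      unfolding B1 IH by (simp add: field_simps power2_eq_square)
  qed
  have B3: "fps_nth B 3 = - ((s1 + d)^3 + 3 * (s1 + d) * (s2 + d^2) + 2 * (s3 + d^3)) / 6
              + ((s1 + d)^2 + (s2 + d^2)) - 3 * (s1 + d) + 4"
  proof -
    have "fps_nth B 3 = fps_nth A 3 + fps_nth A 2 - (d + 1) * fps_nth B 2"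
      using step[of 2] by (simp add: en numeral_3_eq_3 numeral_2_eq_2)
    then show ?thesis
      unfolding B2 IH by (simp add: field_simps power2_eq_square power3_eq_cube)
  qed
  show ?case
    unfolding BB using B0 B1 B2 B3 IH(1)
    by (simp add: s1_def s2_def s3_def d_def)
qed

text \<open>The expressions of the Chern classes through the power sums of the \<open>d\<^sub>i = e\<^sub>i - 1\<close>.\<close>

lemma chern_coeff_explicit:
  fixes X :: complete_intersection
  defines "s \<equiv> excess_power_sum X"
  shows "chern_coeff X 1 = 4 - s 1"
    and "chern_coeff X 2 = ((s 1)^2 + s 2) / 2 - 3 * (s 1 - 2)"
    and "chern_coeff X 3 = - ((s 1)^3 + 3 * s 1 * s 2 + 2 * s 3) / 6 + ((s 1)^2 + s 2) - 3 * s 1 + 4"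
  using total_chern_coeffs[of "ci_codim X" "ci_deg X"]
  by (simp_all add: s_def excess_power_sum_def chern_coeff_def total_chern_def ncoords_def)

lemma canonical_twist_eq_neg_c1: "real_of_int (canonical_twist X) = - chern_coeff X 1"
  unfolding chern_coeff_explicit
  by (simp add: canonical_twist_def excess_power_sum_def ncoords_def sum_subtractf)


section \<open>The cone of Chern number inequalities\<close>

definition chern_cone :: "(real ^ 3) set" where
  "chern_cone = {v. \<forall>X. sci_threefold X \<and> canonical_ample X \<longrightarrow>
     v $ 1 * c1_cubed X + v $ 2 * c1_c2 X + v $ 3 * c3 X \<ge> 0}"

definition line_slope :: "nat \<Rightarrow> real" where
  "line_slope m =
     (if m = 0 then - 242 / 93
      else if m = 1 then - 42
      else if m = 2 then - 22
      else if m = 3 then - 14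
      else if m = 4 then - 9 / 2
      else if m = 5 then - 13 / 4
      else (- 28 * real m + real m ^ 2 + 4 * real m ^ 3 - real m ^ 4) /
           ((real m - 4) * (real m - 3) * (3 * real m ^ 2 - 5 * real m - 20)))"

definition line_intercept :: "nat \<Rightarrow> real" where
  "line_intercept m =
     (if m = 0 then 515 / 93
      else if m = 1 then 8
      else if m = 2 then 6
      else if m = 3 then 5
      else if m = 4 then 41 / 12
      else if m = 5 then 3
      else (- 120 + 254 * real m + 3 * real m ^ 2 - 50 * real m ^ 3 + 9 * real m ^ 4) /
           (3 * (real m - 4) * (real m - 3) * (3 * real m ^ 2 - 5 * real m - 20)))"

definition limit_slope :: real where "limit_slope = - 1 / 3"

definition limit_intercept :: real where "limit_intercept = 1"

definition edge_vectors :: "(real ^ 3) set" where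
  "edge_vectors =
     {vector [- line_slope 0, - line_intercept 0, 1]} \<union>
     {vector [line_slope m, line_intercept m, - 1] | m. m \<ge> 1} \<union>
     {vector [limit_slope, limit_intercept, - 1]}"

end

theory Submission
  imports
    Defs
    "HOL-Computational_Algebra.Polynomial"
    "HOL-Real_Asymp.Real_Asymp"
begin

text \<open>
  A vector lies in the cone if and only if the corresponding affine function is nonpositive at all
  Chern ratios \<open>(x, y)\<close>, because \<open>c\<^sub>1c\<^sub>2 < 0\<close>.  The points \<open>p\<^sub>m\<close> are such ratios: for \<open>m \<ge> 6\<close> of an
  intersection of \<open>m\<close> quadrics, and for \<open>m = 1, \<dots>, 5\<close> of intersections of degrees (6), (4,3), (3,3,2),
  (2,2,2,2,2) and (3,3,3); smooth ones are given by suitable diagonal forms.  All other ratios lie in the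
  convex hull of the \<open>p\<^sub>m\<close> and of their limit: in terms of the power sums \<open>A, B, D\<close> of the \<open>d\<^sub>i\<close>, the
  number \<open>-c\<^sub>3\<close> increases with \<open>D\<close>; the bound \<open>D \<ge> 3B - 2A\<close>, an equality when all \<open>d\<^sub>i \<le> 2\<close>, is
  sharp enough if \<open>A\<close> is not much larger than \<open>m\<close>, and \<open>D \<ge> B\<^sup>2/A\<close> suffices otherwise.  Thus the cone
  is cut out by the \<open>p\<^sub>m\<close>; a vector spans an edge if it vanishes at two neighbouring ones, or at the
  limit point to first order, and every nonzero vector of the cone has a component along an edge.
\<close>


section \<open>Inequalities for power sums\<close>

text \<open>For real parameters the inequalities fail: with all \<open>d_i = 1\<close> the gap of
  line \<open>m\<close> has the factors \<open>A - m\<close> and \<open>A - (m + 1)\<close>, so it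
  is negative strictly between neighbouring vertices. Integrality of \<open>A\<close>, and for small
  \<open>A\<close> that of the single \<open>d_i\<close>, has to enter. The two lower bounds on
  \<open>D\<close> have overlapping ranges of validity; \<open>6 * m / 5\<close> is a point in the
  overlap.

  The cone has infinitely many edges, so no finite list of generators can be inspected. The slope
  orders them: locating a vector between consecutive \<open>k_m\<close> names the vertex that
  supports its line. The limit line has only the limit point to vanish at; the second condition is
  the \<open>1/m\<close> term of \<open>p_m\<close>, whose direction \<open>(-6, 2)\<close> has
  slope \<open>-1/3\<close>.

  The delicate smoothness check is that of degrees (3,3,2). For equal degrees a relation between
  gradients gives a polynomial with too many roots; for these mixed degrees it ties the value of
  each nonzero coordinate to its coefficients, and the weights have to be in general
  position.\<close>

text \<open>With \<open>A, B, D\<close> the first three power sums of the \<open>d\<^sub>i\<close>, this is \<open>k c\<^sub>1\<^sup>3 + b c\<^sub>1c\<^sub>2 - c\<^sub>3\<close> in units of \<open>h\<^sup>3\<close>.\<close>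

definition gap :: "real \<Rightarrow> real \<Rightarrow> real \<Rightarrow> real \<Rightarrow> real \<Rightarrow> real" where
  "gap k b A B D = (A ^ 3 + 3 * A * B + 2 * D) / 6 - (A\<^sup>2 + B) + 3 * A - 4
     - k * (A - 4) ^ 3 - b * (A - 4) * ((A\<^sup>2 + B) / 2 - 3 * (A - 2))"

text \<open>After inserting \<open>D = 3 * B - 2 * A\<close> the gap is affine in \<open>B\<close>
  with slope \<open>(A - b * (A - 4)) / 2\<close>. The last hypothesis makes this nonnegative, so
  the minimum is at \<open>B = A\<close>, where all nonzero \<open>d_i\<close> are 1.\<close>

lemma gap_ge_ones:
  assumes "3 * B - 2 * A \<le> D" "A \<le> B" "b * (A - 4) \<le> A"
  shows "gap k b A A A \<le> gap k b A B D"
proof -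
  have "gap k b A B D - gap k b A A A
      = ((A - b * (A - 4)) * (B - A)) * (1 / 2) + (D - (3 * B - 2 * A)) * (1 / 3)"
    by (simp add: gap_def field_simps power2_eq_square)
  moreover have "0 \<le> (A - b * (A - 4)) * (B - A)"
    using assms by (intro mult_nonneg_nonneg) auto
  moreover have "0 \<le> D - (3 * B - 2 * A)"
    using assms(1) by simp
  ultimately have "0 \<le> gap k b A B D - gap k b A A A"
    by simp
  then show ?thesis by simp
qed

text \<open>The bound \<open>D >= B^2 / A\<close> leaves a quadratic polynomial in \<open>B\<close>;
  \<open>disc\<close> says that its discriminant is nonpositive, and the proof completes the
  square.\<close>

lemma gap_nonneg_cauchy:
  assumes "0 < A" and cs: "B\<^sup>2 \<le> A * D"
    and disc: "3 * A * (A / 2 - 1 - b * (A - 4) / 2)\<^sup>2 \<le> 4 * gap k b A 0 0"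
  shows "0 \<le> gap k b A B D"
proof -
  define \<beta> where "\<beta> = A / 2 - 1 - b * (A - 4) / 2"
  have eq: "gap k b A B D = gap k b A 0 0 + \<beta> * B + D / 3"
    by (simp add: gap_def \<beta>_def field_simps)
  have "12 * A * gap k b A B D
      = (2 * B + 3 * A * \<beta>)\<^sup>2 + 4 * (A * D - B\<^sup>2) + 3 * A * (4 * gap k b A 0 0 - 3 * A * \<beta>\<^sup>2)"
    unfolding eq by (simp add: field_simps power2_eq_square)
  moreover have "0 \<le> 3 * A * (4 * gap k b A 0 0 - 3 * A * \<beta>\<^sup>2)"
    using assms by (intro mult_nonneg_nonneg) (auto simp: \<beta>_def)
  ultimately have "0 \<le> 12 * A * gap k b A B D"
    using cs by simp
  then show ?thesis
    using \<open>0 < A\<close> by (simp add: zero_le_mult_iff)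
qed

text \<open>The thresholds are sharp for this method: on each of the six lines the discriminant
  condition fails at the next smaller integer \<open>A\<close>.\<close>

lemma gap_lines_large:
  assumes "B\<^sup>2 \<le> A * D"
  shows "A \<ge> 6 \<Longrightarrow> 0 \<le> gap (- 42) 8 A B D"
    and "A \<ge> 6 \<Longrightarrow> 0 \<le> gap (- 22) 6 A B D"
    and "A \<ge> 6 \<Longrightarrow> 0 \<le> gap (- 14) 5 A B D"
    and "A \<ge> 7 \<Longrightarrow> 0 \<le> gap (- 9 / 2) (41 / 12) A B D"
    and "A \<ge> 7 \<Longrightarrow> 0 \<le> gap (- 13 / 4) 3 A B D"
    and "A \<ge> 8 \<Longrightarrow> 0 \<le> gap (line_slope 6) (line_intercept 6) A B D"
proof -
  have expand: "\<exists>t\<ge>0. A = c + t" if "A \<ge> c" for c :: real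
    using that by (intro exI[of _ "A - c"]) auto
  show "A \<ge> 6 \<Longrightarrow> 0 \<le> gap (- 42) 8 A B D"
    by (drule expand, rule gap_nonneg_cauchy[OF _ assms])
       (auto simp: gap_def power2_eq_square power3_eq_cube field_simps intro!: add_nonneg_nonneg)
  show "A \<ge> 6 \<Longrightarrow> 0 \<le> gap (- 22) 6 A B D"
    by (drule expand, rule gap_nonneg_cauchy[OF _ assms])
       (auto simp: gap_def power2_eq_square power3_eq_cube field_simps intro!: add_nonneg_nonneg)
  show "A \<ge> 6 \<Longrightarrow> 0 \<le> gap (- 14) 5 A B D"
    by (drule expand, rule gap_nonneg_cauchy[OF _ assms])
       (auto simp: gap_def power2_eq_square power3_eq_cube field_simps intro!: add_nonneg_nonneg)
  show "A \<ge> 7 \<Longrightarrow> 0 \<le> gap (- 9 / 2) (41 / 12) A B D"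
    by (drule expand, rule gap_nonneg_cauchy[OF _ assms])
       (auto simp: gap_def power2_eq_square power3_eq_cube field_simps intro!: add_nonneg_nonneg)
  show "A \<ge> 7 \<Longrightarrow> 0 \<le> gap (- 13 / 4) 3 A B D"
    by (drule expand, rule gap_nonneg_cauchy[OF _ assms])
       (auto simp: gap_def power2_eq_square power3_eq_cube field_simps intro!: add_nonneg_nonneg)
  show "A \<ge> 8 \<Longrightarrow> 0 \<le> gap (line_slope 6) (line_intercept 6) A B D"
    by (drule expand, rule gap_nonneg_cauchy[OF _ assms])
       (auto simp: line_slope_def line_intercept_def gap_def power2_eq_square power3_eq_cube field_simps intro!: add_nonneg_nonneg)
qed

text \<open>These are values of \<open>A\<close> out of reach of the quadratic bound. For fixed
  \<open>A\<close> the gap is affine in \<open>B\<close> and \<open>D\<close>, and the two linear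
  bounds on \<open>D\<close> meet at \<open>B = 2 * A\<close>, where all nonzero \<open>d_i\<close>
  are 2; for \<open>A = 6\<close> this corner is the vertex \<open>p_5\<close>.\<close>

lemma gap_lines_small:
  assumes "A \<le> B" "3 * B - 2 * A \<le> D" "5 * B - 6 * A \<le> D"
  shows "A = 5 \<Longrightarrow> 0 \<le> gap (- 14) 5 A B D"
    and "A \<in> {5, 6} \<Longrightarrow> 0 \<le> gap (- 9 / 2) (41 / 12) A B D"
    and "A \<in> {5, 6} \<Longrightarrow> 0 \<le> gap (- 13 / 4) 3 A B D"
    and "A \<in> {5, 6, 7} \<Longrightarrow> 0 \<le> gap (line_slope 6) (line_intercept 6) A B D"
  using assms by (auto simp: gap_def line_slope_def line_intercept_def field_simps)

text \<open>Intercept 1 gives \<open>b * (A - 4) = A - 4 <= A\<close> for every \<open>A\<close>, so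
  the comparison with quadrics covers the whole range.\<close>

lemma gap_limit_line:
  assumes "A \<le> B" "3 * B - 2 * A \<le> D" "A \<ge> 5"
  shows "0 \<le> gap limit_slope limit_intercept A B D"
proof -
  have "gap limit_slope limit_intercept A A A = (7 * A - 4) / 3"
    by (simp add: gap_def limit_slope_def limit_intercept_def power2_eq_square power3_eq_cube field_simps)
  moreover have "gap limit_slope limit_intercept A A A \<le> gap limit_slope limit_intercept A B D"
    using assms by (intro gap_ge_ones) (auto simp: limit_intercept_def)
  ultimately show ?thesis using assms by simp
qed

text \<open>With \<open>D\<close> replaced by its upper bound \<open>A * B\<close> the gap is affine
  in \<open>B\<close>, and the sign of its slope changes between \<open>A = 5\<close> and
  \<open>A = 6\<close>. For \<open>A = 5\<close> the largest value is at \<open>B = 25\<close>,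
  \<open>D = 125\<close>, the sextic, where it is 0; for \<open>A >= 6\<close> it is at
  \<open>B = A\<close>.\<close>

lemma gap_upper_line:
  assumes "A \<le> B" "B \<le> A\<^sup>2" "D \<le> A * B" and A: "A = 5 \<or> A \<ge> 6"
  shows "gap (line_slope 0) (line_intercept 0) A B D \<le> 0"
  using A
proof
  assume "A = 5"
  then show ?thesis using assms(1-3)
    by (auto simp: gap_def line_slope_def line_intercept_def)
next
  assume "A \<ge> 6"
  have "gap (line_slope 0) (line_intercept 0) A B D \<le> gap (line_slope 0) (line_intercept 0) A B (A * B)"
    using assms by (simp add: gap_def)
  also have "\<dots> = gap (line_slope 0) (line_intercept 0) A A (A * A)
      - (B - A) * ((515 / 186 - 5 / 6) * A + 1 - 1030 / 93)"
    by (simp add: gap_def line_slope_def line_intercept_def field_simps power2_eq_square)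
  also have "\<dots> \<le> gap (line_slope 0) (line_intercept 0) A A (A * A)"
    using assms \<open>A \<ge> 6\<close> by (auto intro!: mult_nonneg_nonneg)
  also have "\<dots> \<le> 0"
  proof -
    obtain t where "A = 6 + t" "t \<ge> 0" using \<open>A \<ge> 6\<close> by (metis diff_ge_0_iff_ge le_add_diff_inverse)
    then show ?thesis
      by (auto simp: gap_def line_slope_def line_intercept_def power2_eq_square power3_eq_cube field_simps intro!: add_nonneg_nonneg order_trans[OF _ add_nonneg_nonneg])
  qed
  finally show ?thesis .
qed

section \<open>The lines through the ratios of \<open>m\<close> and \<open>m + 1\<close>
  quadrics\<close>

definition line_denom :: "real \<Rightarrow> real" where
  "line_denom m = 3 * ((m - 4) * (m - 3) * (3 * m\<^sup>2 - 5 * m - 20))"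

definition slope_num :: "real \<Rightarrow> real" where
  "slope_num m = 3 * (- 28 * m + m\<^sup>2 + 4 * m ^ 3 - m ^ 4)"

definition intercept_num :: "real \<Rightarrow> real" where
  "intercept_num m = - 120 + 254 * m + 3 * m\<^sup>2 - 50 * m ^ 3 + 9 * m ^ 4"

lemmas line_num_defs = line_denom_def slope_num_def intercept_num_def

lemma line_denom_pos:
  assumes "m \<ge> 6"
  shows "0 < line_denom m"
proof -
  have "6 * m \<le> m\<^sup>2" using assms by (simp add: power2_eq_square)
  then have "0 < 3 * m\<^sup>2 - 5 * m - 20" using assms by linarith
  then show ?thesis using assms by (simp add: line_denom_def)
qed

lemma line_slope_intercept_eq:
  assumes "m \<ge> 6"
  shows "line_slope m = slope_num (real m) / line_denom (real m)"
    and "line_intercept m = intercept_num (real m) / line_denom (real m)"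
proof -
  show "line_slope m = slope_num (real m) / line_denom (real m)"
    unfolding slope_num_def line_denom_def using assms
    by (subst mult_divide_mult_cancel_left) (auto simp: line_slope_def)
  show "line_intercept m = intercept_num (real m) / line_denom (real m)"
    using assms by (auto simp: line_intercept_def line_num_defs)
qed

text \<open>For \<open>B = D = A\<close> the gap is a cubic polynomial in \<open>A\<close>. Two of
  its roots are \<open>m\<close> and \<open>m + 1\<close>, since the line passes through the ratios
  of \<open>m\<close> and of \<open>m + 1\<close> quadrics; the remaining factor is affine in
  \<open>A\<close>.\<close>

lemma gap_ones:
  assumes "m \<ge> 6"
  shows "gap (line_slope m) (line_intercept m) A A A
    = (A - m) * (A - (m + 1)) * (3 * A * (7 * (real m)\<^sup>2 - real m - 20) - 12 * (real m + 4) * (real m + 5))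
      / line_denom m"
proof -
  define x where "x = real m"
  have pos: "line_denom x \<noteq> 0" using line_denom_pos[of x] assms by (simp add: x_def)
  have "gap (slope_num x / line_denom x) (intercept_num x / line_denom x) A A A * line_denom x
      = line_denom x * ((A ^ 3 + 3 * A * A + 2 * A) / 6 - (A\<^sup>2 + A) + 3 * A - 4)
        - slope_num x * (A - 4) ^ 3 - intercept_num x * (A - 4) * ((A\<^sup>2 + A) / 2 - 3 * (A - 2))"
    using pos by (simp add: gap_def field_simps)
  also have "\<dots> = (A - x) * (A - (x + 1)) * (3 * A * (7 * x\<^sup>2 - x - 20) - 12 * (x + 4) * (x + 5))"
    unfolding line_num_defs by (simp add: field_simps power2_eq_square power3_eq_cube power4_eq_xxxx)
  finally show ?thesis
    unfolding line_slope_intercept_eq[OF assms] x_def[symmetric]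
    using pos by (simp add: x_def[symmetric] eq_divide_eq)
qed

text \<open>No integer lies strictly between \<open>m\<close> and \<open>m + 1\<close>, and the root
  of the affine factor is below 5.\<close>

lemma gap_ones_nonneg:
  assumes "m \<ge> 6" "n \<ge> (5::nat)"
  shows "0 \<le> gap (line_slope m) (line_intercept m) n n n"
proof -
  have "0 \<le> (real n - m) * (real n - (m + 1))"
    by (cases "n \<le> m") (auto intro: mult_nonneg_nonneg mult_nonpos_nonpos)
  moreover have "0 \<le> 3 * real n * (7 * (real m)\<^sup>2 - real m - 20) - 12 * (real m + 4) * (real m + 5)"
  proof -
    have sq: "6 * real m \<le> (real m)\<^sup>2" using assms by (simp add: power2_eq_square)
    then have *: "0 \<le> 7 * (real m)\<^sup>2 - m - 20" using assms by linarith
    \<comment> \<open>The factor 15 is \<open>3 * n\<close> at the smallest admissible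
      \<open>n = 5\<close>.\<close>
    have "12 * (real m + 4) * (m + 5) \<le> 15 * (7 * (real m)\<^sup>2 - m - 20)"
    proof -
      have "123 * real m + 540 \<le> 93 * (real m)\<^sup>2"
        using sq assms(1) by linarith
      then show ?thesis by (simp add: algebra_simps power2_eq_square)
    qed
    also have "\<dots> \<le> 3 * real n * (7 * (real m)\<^sup>2 - m - 20)"
      using * assms by (intro mult_right_mono) auto
    finally show ?thesis by simp
  qed
  ultimately show ?thesis
    unfolding gap_ones[OF assms(1)] using line_denom_pos[of m] assms by simp
qed

lemma intercept_slope_bound:
  assumes "m \<ge> 7" and A: "A \<le> 6 * m / 5"
  shows "intercept_num m * (A - 4) \<le> line_denom m * A"
proof -
  obtain p where p: "m = 7 + p" "p \<ge> 0"
    using \<open>m \<ge> 7\<close> by (metis diff_ge_0_iff_ge le_add_diff_inverse)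
  have "0 \<le> intercept_num m - line_denom m"
    unfolding line_num_defs p(1) using p(2)
    by (auto simp: field_simps power2_eq_square power3_eq_cube power4_eq_xxxx intro!: add_nonneg_nonneg)
  then have "(intercept_num m - line_denom m) * A \<le> (intercept_num m - line_denom m) * (6 * m / 5)"
    using A by (intro mult_left_mono)
  also have "\<dots> \<le> 4 * intercept_num m"
    unfolding line_num_defs p(1) using p(2)
    by (auto simp: field_simps power2_eq_square power3_eq_cube power4_eq_xxxx intro!: add_nonneg_nonneg)
  finally show ?thesis by (simp add: algebra_simps)
qed

text \<open>This is the hypothesis \<open>disc\<close> of \<open>gap_nonneg_cauchy\<close>,
  multiplied by \<open>line_denom m ^ 2\<close>. For large \<open>m\<close> it holds from slightly
  above \<open>1.03 * m\<close> on; from \<open>6 * m / 5\<close> on, the substitution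
  \<open>m = 7 + p\<close>, \<open>5 * A = 6 * m + t\<close> leaves only nonnegative
  coefficients.\<close>

lemma discriminant_bound:
  assumes "m \<ge> 7" and A: "6 * m / 5 \<le> A"
  shows "3 * A * (line_denom m * (A / 2 - 1) - intercept_num m * (A - 4) / 2)\<^sup>2
    \<le> 4 * line_denom m * (line_denom m * (A ^ 3 / 6 - A\<^sup>2 + 3 * A - 4) - slope_num m * (A - 4) ^ 3
        - intercept_num m * (A - 4) * (A\<^sup>2 / 2 - 3 * (A - 2)))" (is "?l \<le> ?r")
proof -
  define p t where "p = m - 7" and "t = 5 * A - 6 * m"
  have nonneg: "0 \<le> p" "0 \<le> t"
    using assms by (simp_all add: p_def t_def)
  have eqs: "m = 7 + p" "5 * A = 42 + 6 * p + t"
    by (simp_all add: p_def t_def)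
  \<comment> \<open>The factor \<open>500 = 4 * 5 ^ 3\<close> clears the halves and the powers of
    \<open>A = (6 * m + t) / 5\<close>.\<close>
  have "500 * (?r - ?l) =
        11700122112 + 29511648000 * p + 29991996576 * p ^ 2 + 16573655232 * p ^ 3
         + 5560327944 * p ^ 4 + 1182460536 * p ^ 5 + 160014960 * p ^ 6 + 13321008 * p ^ 7
         + 620136 * p ^ 8 + 12312 * p ^ 9 + 8381968128 * t + 15200217216 * p * t
         + 11637234096 * p ^ 2 * t + 4909265280 * p ^ 3 * t + 1246416036 * p ^ 4 * t
         + 194700816 * p ^ 5 * t + 18247272 * p ^ 6 * t + 937296 * p ^ 7 * t + 20196 * p ^ 8 * t
         + 871772544 * t ^ 2 + 1299663936 * p * t ^ 2 + 799805400 * p ^ 2 * t ^ 2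
         + 262429920 * p ^ 3 * t ^ 2 + 49400448 * p ^ 4 * t ^ 2 + 5319504 * p ^ 5 * t ^ 2
         + 303144 * p ^ 6 * t ^ 2 + 7056 * p ^ 7 * t ^ 2 + 24093504 * t ^ 3
         + 28973664 * p * t ^ 3 + 13799508 * p ^ 2 * t ^ 3 + 3310776 * p ^ 3 * t ^ 3
         + 420180 * p ^ 4 * t ^ 3 + 26784 * p ^ 5 * t ^ 3 + 672 * p ^ 6 * t ^ 3"
    using eqs line_denom_def[of m] slope_num_def[of m] intercept_num_def[of m] by algebra
  also have "\<dots> \<ge> 0"
    using nonneg by (intro add_nonneg_nonneg mult_nonneg_nonneg zero_le_power) auto
  finally show ?thesis by simp
qed

lemma gap_line_ge_7:
  assumes "m \<ge> 7" "n \<ge> (5::nat)"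
    and "real n \<le> B" "3 * B - 2 * real n \<le> D" "B\<^sup>2 \<le> n * D"
  shows "0 \<le> gap (line_slope m) (line_intercept m) n B D"
proof -
  have pos: "0 < line_denom m" using line_denom_pos[of m] assms(1) by simp
  have m6: "m \<ge> 6" using assms(1) by simp
  show ?thesis
  proof (cases "n \<le> 6 * real m / 5")
    case True
    have "line_intercept m * (real n - 4) \<le> n"
      using intercept_slope_bound[OF _ True] assms(1) pos
      by (simp add: line_slope_intercept_eq[OF m6] field_simps)
    then have "gap (line_slope m) (line_intercept m) n n n \<le> gap (line_slope m) (line_intercept m) n B D"
      using assms by (intro gap_ge_ones) auto
    then show ?thesis using gap_ones_nonneg[OF m6 assms(2)] by simp
  next
    case False
    define q k b where "q = line_denom m" and "k = slope_num m" and "b = intercept_num m"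
    define x where "x = real n"
    have le: "3 * x * (q * (x / 2 - 1) - b * (x - 4) / 2)\<^sup>2
      \<le> 4 * q * (q * (x ^ 3 / 6 - x\<^sup>2 + 3 * x - 4) - k * (x - 4) ^ 3 - b * (x - 4) * (x\<^sup>2 / 2 - 3 * (x - 2)))"
      unfolding q_def k_def b_def x_def using False assms(1) by (intro discriminant_bound) auto
    have "q * (x / 2 - 1) - b * (x - 4) / 2 = q * (x / 2 - 1 - b / q * (x - 4) / 2)"
      using pos unfolding q_def[symmetric] by (simp add: field_simps)
    moreover have "q * (x ^ 3 / 6 - x\<^sup>2 + 3 * x - 4) - k * (x - 4) ^ 3 - b * (x - 4) * (x\<^sup>2 / 2 - 3 * (x - 2))
       = q * gap (k / q) (b / q) x 0 0"
      using pos unfolding q_def[symmetric] gap_def by (simp add: field_simps)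
    ultimately have "q\<^sup>2 * (3 * x * (x / 2 - 1 - b / q * (x - 4) / 2)\<^sup>2) \<le> q\<^sup>2 * (4 * gap (k / q) (b / q) x 0 0)"
      using le by (simp add: power_mult_distrib power2_eq_square mult_ac)
    then have "3 * x * (x / 2 - 1 - b / q * (x - 4) / 2)\<^sup>2 \<le> 4 * gap (k / q) (b / q) x 0 0"
      by (rule mult_left_le_imp_le) (use pos in \<open>simp add: q_def\<close>)
    then show ?thesis
      using assms unfolding line_slope_intercept_eq[OF m6]
      by (intro gap_nonneg_cauchy) (auto simp: x_def q_def k_def b_def)
  qed
qed

section \<open>Integrality of the power sums\<close>

text \<open>The triples belong to the partitions of the numbers up to 5; the smaller sums are listed
  for the induction, which adds one part at a time.\<close>

lemma power_sums_of_sum_le_5: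
  fixes d :: "nat \<Rightarrow> nat"
  assumes "(\<Sum>i<n. d i) \<le> 5"
  shows "((\<Sum>i<n. d i), (\<Sum>i<n. d i ^ 2), (\<Sum>i<n. d i ^ 3)) \<in>
    {(0,0,0), (1,1,1), (2,2,2), (2,4,8), (3,3,3), (3,5,9), (3,9,27), (4,4,4), (4,6,10), (4,8,16),
     (4,10,28), (4,16,64), (5,5,5), (5,7,11), (5,9,17), (5,11,29), (5,13,35), (5,17,65), (5,25,125)}"
    (is "_ \<in> ?T")
  using assms
proof (induction n)
  case (Suc n)
  have step: "(a + x, b + x ^ 2, c + x ^ 3) \<in> ?T" if "(a, b, c) \<in> ?T" "a + x \<le> 5" for a b c x :: nat
  proof -
    have "x = 0 \<or> x = 1 \<or> x = 2 \<or> x = 3 \<or> x = 4 \<or> x = 5"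
      using that(2) by linarith
    then show ?thesis
      using that by (elim disjE insertE emptyE) simp_all
  qed
  have "((\<Sum>i<n. d i), (\<Sum>i<n. d i ^ 2), (\<Sum>i<n. d i ^ 3)) \<in> ?T"
    by (rule Suc.IH) (use Suc.prems in simp)
  from step[OF this, of "d n"] Suc.prems show ?case
    by (simp only: sum.lessThan_Suc)
qed simp

text \<open>The differences are \<open>d * (d - 1) * (d - 2)\<close> and
  \<open>d * (d - 2) * (d - 3)\<close>: no integer lies strictly between two consecutive ones.
  Equality holds for \<open>d\<close> in 0, 1, 2 and in 0, 2, 3, which puts the corner of the joint
  bound at \<open>d = 2\<close>.\<close>

lemma cube_ge_linear_combination:
  fixes d :: nat
  shows "3 * real d ^ 2 - 2 * real d \<le> real d ^ 3"
    and "5 * real d ^ 2 - 6 * real d \<le> real d ^ 3"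
proof -
  have eqs: "real d ^ 3 - (3 * real d ^ 2 - 2 * real d) = real d * ((real d - 1) * (real d - 2))"
    "real d ^ 3 - (5 * real d ^ 2 - 6 * real d) = real d * ((real d - 2) * (real d - 3))"
    by (simp_all add: power2_eq_square power3_eq_cube algebra_simps)
  have "0 \<le> (real d - 1) * (real d - 2)"
    by (cases "d \<le> 1") (auto simp: zero_le_mult_iff)
  moreover have "0 \<le> (real d - 2) * (real d - 3)"
    by (cases "d \<le> 2") (auto simp: zero_le_mult_iff)
  ultimately have "0 \<le> real d ^ 3 - (3 * real d ^ 2 - 2 * real d)"
    "0 \<le> real d ^ 3 - (5 * real d ^ 2 - 6 * real d)"
    unfolding eqs by simp_all
  then show "3 * real d ^ 2 - 2 * real d \<le> real d ^ 3" "5 * real d ^ 2 - 6 * real d \<le> real d ^ 3"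
    by linarith+
qed

lemma power_sum_bounds:
  fixes d :: "nat \<Rightarrow> nat" and n :: nat
  defines "s j \<equiv> (\<Sum>i<n. real (d i) ^ j)"
  shows "s 1 \<le> s 2" "s 2 \<le> (s 1)\<^sup>2" "s 3 \<le> s 1 * s 2"
    and "3 * s 2 - 2 * s 1 \<le> s 3" "5 * s 2 - 6 * s 1 \<le> s 3" "(s 2)\<^sup>2 \<le> s 1 * s 3"
proof -
  have le: "real (d i) \<le> s 1" if "i < n" for i
    unfolding s_def using that by (auto intro: member_le_sum[of i "{..<n}" "\<lambda>i. real (d i)"])
  show "s 1 \<le> s 2"
    unfolding s_def by (auto intro!: sum_mono simp: power2_eq_square simp flip: of_nat_mult)
  show "s 2 \<le> (s 1)\<^sup>2"
    unfolding power2_eq_square s_def[of 2] s_def[of 1]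
    by (auto simp: sum_distrib_left power2_eq_square le[unfolded s_def, simplified] intro!: sum_mono mult_right_mono)
  show "s 3 \<le> s 1 * s 2"
    unfolding s_def[of 3] s_def[of 2]
    by (auto simp: sum_distrib_left power2_eq_square power3_eq_cube mult.assoc le[simplified] intro!: sum_mono mult_right_mono)
  show "3 * s 2 - 2 * s 1 \<le> s 3" "5 * s 2 - 6 * s 1 \<le> s 3"
    unfolding s_def sum_distrib_left sum_subtractf[symmetric] power_one_right
    by (intro sum_mono cube_ge_linear_combination)+
  \<comment> \<open>Cauchy-Schwarz for the splitting of \<open>d ^ 2\<close> into the square roots
    of \<open>d\<close> and \<open>d ^ 3\<close>.\<close>
  have "(\<Sum>i<n. sqrt (d i) * sqrt (d i ^ 3))\<^sup>2 \<le> (\<Sum>i<n. (sqrt (d i))\<^sup>2) * (\<Sum>i<n. (sqrt (d i ^ 3))\<^sup>2)"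
    by (rule Cauchy_Schwarz_ineq_sum)
  moreover have "sqrt (d i) * sqrt (d i ^ 3) = real (d i) ^ 2" for i
  proof -
    have "sqrt (d i) * sqrt (d i ^ 3) = sqrt ((real (d i) ^ 2)\<^sup>2)"
      by (simp add: power2_eq_square power3_eq_cube mult_ac flip: real_sqrt_mult)
    then show ?thesis
      by (simp only: real_sqrt_abs abs_power2)
  qed
  ultimately show "(s 2)\<^sup>2 \<le> s 1 * s 3"
    unfolding s_def by simp
qed

lemma gap_edge_lines:
  fixes d :: "nat \<Rightarrow> nat" and n :: nat
  defines "s j \<equiv> (\<Sum>i<n. real (d i) ^ j)"
  assumes "5 \<le> (\<Sum>i<n. d i)"
  shows "gap (line_slope 0) (line_intercept 0) (s 1) (s 2) (s 3) \<le> 0"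
    and "m \<ge> 1 \<Longrightarrow> 0 \<le> gap (line_slope m) (line_intercept m) (s 1) (s 2) (s 3)"
    and "0 \<le> gap limit_slope limit_intercept (s 1) (s 2) (s 3)"
proof -
  define N where "N = (\<Sum>i<n. d i)"
  have N: "s 1 = real N" "N \<ge> 5"
    using assms(2) by (simp_all add: s_def N_def)
  note bounds = power_sum_bounds[of d n, folded s_def]
  have bounds': "real N \<le> s 2" "3 * s 2 - 2 * real N \<le> s 3" "5 * s 2 - 6 * real N \<le> s 3"
     "(s 2)\<^sup>2 \<le> real N * s 3"
    using bounds by (simp_all only: N(1))
  have five: "(s 2, s 3) \<in> {(5,5), (7,11), (9,17), (11,29), (13,35), (17,65), (25,125)}" if "N = 5"
  proof -
    define b c where "b = (\<Sum>i<n. d i ^ 2)" and "c = (\<Sum>i<n. d i ^ 3)"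
    have bc: "s 2 = real b" "s 3 = real c"
      by (simp_all add: s_def b_def c_def)
    have "(b, c) \<in> {(5,5), (7,11), (9,17), (11,29), (13,35), (17,65), (25,125)}"
      using power_sums_of_sum_le_5[of d n] that
      by (simp only: N_def[symmetric] b_def[symmetric] c_def[symmetric]) simp
    then show ?thesis
      unfolding bc by (elim insertE emptyE) simp_all
  qed
  show "gap (line_slope 0) (line_intercept 0) (s 1) (s 2) (s 3) \<le> 0"
    using bounds N by (intro gap_upper_line) auto
  show "0 \<le> gap limit_slope limit_intercept (s 1) (s 2) (s 3)"
    using bounds N by (intro gap_limit_line) auto
  assume "m \<ge> 1"
  then consider "m = 1" | "m = 2" | "m = 3" | "m = 4" | "m = 5" | "m = 6" | "m \<ge> 7"
    by linarith
  then show "0 \<le> gap (line_slope m) (line_intercept m) (s 1) (s 2) (s 3)"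
  proof cases
    case 1
    have "0 \<le> gap (- 42) 8 (real N) (s 2) (s 3)"
      using five gap_lines_large(1)[OF bounds'(4)] N(2)
      by (cases "N = 5") (auto simp: gap_def)
    then show ?thesis unfolding N(1) 1 by (simp add: line_slope_def line_intercept_def)
  next
    case 2
    have "0 \<le> gap (- 22) 6 (real N) (s 2) (s 3)"
      using five gap_lines_large(2)[OF bounds'(4)] N(2)
      by (cases "N = 5") (auto simp: gap_def)
    then show ?thesis unfolding N(1) 2 by (simp add: line_slope_def line_intercept_def)
  next
    case 3
    have "0 \<le> gap (- 14) 5 (real N) (s 2) (s 3)"
      using gap_lines_small(1)[OF bounds'(1-3)] gap_lines_large(3)[OF bounds'(4)] N(2)
      by (cases "N = 5") auto
    then show ?thesis unfolding N(1) 3 by (simp add: line_slope_def line_intercept_def)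
  next
    case 4
    have "0 \<le> gap (- 9 / 2) (41 / 12) (real N) (s 2) (s 3)"
      using gap_lines_small(2)[OF bounds'(1-3)] gap_lines_large(4)[OF bounds'(4)] N(2)
      by (cases "N = 5 \<or> N = 6") auto
    then show ?thesis unfolding N(1) 4 by (simp add: line_slope_def line_intercept_def)
  next
    case 5
    have "0 \<le> gap (- 13 / 4) 3 (real N) (s 2) (s 3)"
      using gap_lines_small(3)[OF bounds'(1-3)] gap_lines_large(5)[OF bounds'(4)] N(2)
      by (cases "N = 5 \<or> N = 6") auto
    then show ?thesis unfolding N(1) 5 by (simp add: line_slope_def line_intercept_def)
  next
    case 6
    then show ?thesis
      using gap_lines_small(4)[OF bounds'(1-3)] gap_lines_large(6)[OF bounds'(4)] N
      by (cases "N = 5 \<or> N = 6 \<or> N = 7") auto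
  next
    case 7
    then show ?thesis
      unfolding N(1) using N(2) bounds' by (intro gap_line_ge_7)
  qed
qed


section \<open>Forms and ampleness\<close>

text \<open>Gaussian elimination: the last equation is solved for a variable \<open>p\<close> with
  nonzero coefficient, and \<open>c\<close> is the reduced matrix on the other variables.\<close>

lemma homogeneous_system_nontrivial:
  fixes M :: "nat \<Rightarrow> nat \<Rightarrow> 'a::field"
  assumes "finite J" "n < card J"
  obtains v where "\<And>j. j \<notin> J \<Longrightarrow> v j = 0" "v \<noteq> (\<lambda>_. 0)" "\<And>i. i < n \<Longrightarrow> (\<Sum>j\<in>J. M i j * v j) = 0"
proof -
  have "\<exists>v. (\<forall>j. j \<notin> J \<longrightarrow> v j = 0) \<and> v \<noteq> (\<lambda>_. 0) \<and> (\<forall>i<n. (\<Sum>j\<in>J. M i j * v j) = 0)"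
    using assms
  proof (induction n arbitrary: J M)
    case 0
    then obtain p where "p \<in> J" by force
    then show ?case
      by (intro exI[of _ "\<lambda>j. if j = p then 1 else 0"]) (auto simp: fun_eq_iff)
  next
    case (Suc n)
    show ?case
    proof (cases "\<forall>j\<in>J. M n j = 0")
      case True
      from Suc.IH[of J M] Suc.prems obtain v
        where "\<forall>j. j \<notin> J \<longrightarrow> v j = 0" "v \<noteq> (\<lambda>_. 0)" "\<forall>i<n. (\<Sum>j\<in>J. M i j * v j) = 0"
        by auto
      then show ?thesis
        using True by (intro exI[of _ v]) (auto simp: less_Suc_eq)
    next
      case False
      then obtain p where p: "p \<in> J" "M n p \<noteq> 0" by blast
      define K where "K = J - {p}"
      define c where "c i j = M i j - M i p * M n j / M n p" for i j
      have "finite K" "n < card K"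
        using Suc.prems p by (auto simp: K_def)
      from Suc.IH[OF this, of c] obtain v
        where v: "\<forall>j. j \<notin> K \<longrightarrow> v j = 0" "v \<noteq> (\<lambda>_. 0)" "\<forall>i<n. (\<Sum>j\<in>K. c i j * v j) = 0"
        by auto
      define w where "w = v(p := - (\<Sum>j\<in>K. M n j * v j) / M n p)"
      have split: "(\<Sum>j\<in>J. M i j * w j) = M i p * w p + (\<Sum>j\<in>K. M i j * v j)" for i
        using p(1) Suc.prems(1) by (simp add: K_def w_def sum.remove)
      have "(\<Sum>j\<in>J. M i j * w j) = 0" if "i < Suc n" for i
      proof (cases "i = n")
        case True
        then show ?thesis unfolding split using p(2) by (simp add: w_def)
      next
        case False
        then have "(\<Sum>j\<in>K. c i j * v j) = 0" using v(3) that by auto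
        then have "(\<Sum>j\<in>K. M i j * v j) = (\<Sum>j\<in>K. M i p * M n j / M n p * v j)"
          by (simp add: c_def left_diff_distrib sum_subtractf)
        also have "\<dots> = M i p / M n p * (\<Sum>j\<in>K. M n j * v j)"
          by (simp add: sum_distrib_left mult_ac)
        finally show ?thesis unfolding split by (simp add: w_def)
      qed
      moreover have "w \<noteq> (\<lambda>_. 0)"
      proof -
        obtain j where "v j \<noteq> 0" using v(2) by auto
        then have "w j \<noteq> 0" using v(1) by (auto simp: w_def K_def)
        then show ?thesis by auto
      qed
      moreover have "w j = 0" if "j \<notin> J" for j
        using that v(1) p(1) by (auto simp: w_def K_def)
      ultimately show ?thesis by blast
    qed
  qed
  then show thesis using that by blast
qed

lemma is_form_monomial:
  assumes "\<beta> \<in> exponents N e"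
  shows "is_form N e (\<lambda>x. c * (\<Prod>j<N. x j ^ \<beta> j))"
  unfolding is_form_def
proof (intro exI allI)
  fix x :: "nat \<Rightarrow> complex"
  show "c * (\<Prod>j<N. x j ^ \<beta> j)
      = (\<Sum>\<alpha>\<in>exponents N e. (if \<alpha> = \<beta> then c else 0) * (\<Prod>j<N. x j ^ \<alpha> j))"
    using assms finite_exponents[of N e] by (simp add: if_distrib[of "\<lambda>a. a * _"] sum.delta' cong: if_cong)
qed

lemma is_form_zero: "is_form N e (\<lambda>_. 0)"
  unfolding is_form_def by (rule exI[of _ "\<lambda>_. 0"]) simp

lemma is_form_add:
  assumes "is_form N e f" "is_form N e g"
  shows "is_form N e (\<lambda>x. f x + g x)"
proof -
  obtain a b where "\<forall>x. f x = (\<Sum>\<alpha>\<in>exponents N e. a \<alpha> * (\<Prod>j<N. x j ^ \<alpha> j))"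
    "\<forall>x. g x = (\<Sum>\<alpha>\<in>exponents N e. b \<alpha> * (\<Prod>j<N. x j ^ \<alpha> j))"
    using assms unfolding is_form_def by blast
  then show ?thesis
    unfolding is_form_def
    by (intro exI[of _ "\<lambda>\<alpha>. a \<alpha> + b \<alpha>"]) (simp add: distrib_right sum.distrib)
qed

lemma is_form_sum:
  assumes "\<And>i. i \<in> I \<Longrightarrow> is_form N e (f i)"
  shows "is_form N e (\<lambda>x. \<Sum>i\<in>I. f i x)"
  using assms by (induction I rule: infinite_finite_induct) (auto intro: is_form_zero is_form_add)

lemma is_form_power_times_coord:
  assumes "p < N" "q < N"
  shows "is_form N (Suc k) (\<lambda>x. c * (x p ^ k * x q))"
proof -
  \<comment> \<open>A sum of two indicators also covers \<open>p = q\<close>, where the exponent is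
    \<open>k + 1\<close>.\<close>
  define \<beta> where "\<beta> j = (if j = p then k else 0) + (if j = q then 1 else (0::nat))" for j
  have "\<beta> \<in> exponents N (Suc k)"
    using assms by (auto simp: \<beta>_def exponents_def sum.distrib)
  moreover have "(\<Prod>j<N. x j ^ \<beta> j) = x p ^ k * x q" for x :: "nat \<Rightarrow> complex"
    using assms
    by (simp add: \<beta>_def power_add prod.distrib if_distrib[of "\<lambda>a. _ ^ a"] cong: if_cong)
  ultimately show ?thesis
    using is_form_monomial[of \<beta> N "Suc k" c] by simp
qed

lemma is_form_diagonal:
  assumes "e > 0"
  shows "is_form N e (\<lambda>x. \<Sum>j<N. a j * x j ^ e)"
proof (rule is_form_sum)
  fix j assume "j \<in> {..<N}"
  then show "is_form N e (\<lambda>x. a j * x j ^ e)"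
    using is_form_power_times_coord[of j N j "e - 1" "a j"] assms
    by (cases e) (auto simp: mult_ac)
qed

lemma partial_diagonal:
  assumes "i < N"
  shows "partial i (\<lambda>x. \<Sum>j<N. a j * x j ^ e) x = a i * (of_nat e * x i ^ (e - 1))"
proof -
  have "((\<lambda>t. \<Sum>j<N. a j * (x(i := t)) j ^ e) has_field_derivative
     (\<Sum>j<N. if j = i then a i * (of_nat e * x i ^ (e - 1)) else 0)) (at (x i))"
    by (intro DERIV_sum) (auto intro!: derivative_eq_intros)
  then show ?thesis
    unfolding partial_def using assms by (simp add: DERIV_imp_deriv)
qed

text \<open>As a function of \<open>z\<close> this is a 2 by 2 minor of \<open>x\<close> and
  \<open>z\<close>, hence zero at \<open>z = x\<close>. The factor \<open>z r ^ k\<close> raises the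
  degree to \<open>k + 1\<close> and stays nonzero where the \<open>r\<close>-th coordinate
  does.\<close>

definition separating_form :: "nat \<Rightarrow> nat \<Rightarrow> (nat \<Rightarrow> complex) \<Rightarrow> nat \<Rightarrow> nat \<Rightarrow> (nat \<Rightarrow> complex) \<Rightarrow> complex" where
  "separating_form r k x p q z = x p * (z r ^ k * z q) + (- x q) * (z r ^ k * z p)"

lemma is_form_separating:
  assumes "r < N" "p < N" "q < N"
  shows "is_form N (Suc k) (separating_form r k x p q)"
  unfolding separating_form_def [abs_def]
  using assms by (intro is_form_add is_form_power_times_coord)

text \<open>The minor vanishes at \<open>x\<close>, so the product rule leaves only its own
  derivative, also if \<open>r\<close> is \<open>p\<close> or \<open>q\<close>.\<close>

lemma differential_separating:
  assumes "p < N" "q < N"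
  shows "differential N (separating_form r k x p q) x v = x r ^ k * (x p * v q - x q * v p)"
proof -
  have partial: "partial j (separating_form r k x p q) x
      = x r ^ k * ((if j = q then x p else 0) - (if j = p then x q else 0))" for j
  proof -
    have "((\<lambda>t. (x(j := t)) i) has_field_derivative (if j = i then 1 else 0)) (at (x j))" for i
      by (auto intro!: derivative_eq_intros)
    note d = this
    have "((\<lambda>t. (x(j := t)) r ^ k * (x p * (x(j := t)) q - x q * (x(j := t)) p)) has_field_derivative
       x r ^ k * ((if j = q then x p else 0) - (if j = p then x q else 0))) (at (x j))"
      by (rule derivative_eq_intros d refl)+ (auto simp: algebra_simps)
    then show ?thesis
      unfolding partial_def separating_form_def by (simp add: DERIV_imp_deriv algebra_simps)
  qed
  have "differential N (separating_form r k x p q) x v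
      = (\<Sum>j<N. (if j = q then x r ^ k * (x p * v j) else 0) - (if j = p then x r ^ k * (x q * v j) else 0))"
    unfolding differential_def partial by (intro sum.cong) auto
  then show ?thesis
    using assms by (simp add: sum_subtractf right_diff_distrib)
qed

lemma not_proportional_minor:
  fixes x y :: "nat \<Rightarrow> complex"
  assumes x: "x \<in> coord_space N" and y: "y \<in> coord_space N"
    and "x p \<noteq> 0" and "\<nexists>c. y = (\<lambda>j. c * x j)"
  obtains q where "q < N" "x p * y q - x q * y p \<noteq> 0"
proof -
  have "y \<noteq> (\<lambda>j. y p / x p * x j)" using assms(4) by blast
  then obtain q where q: "y q \<noteq> y p / x p * x q" by auto
  then have "q < N"
    using x y by (cases "q < N") (auto simp: coord_space_def)
  moreover have "x p * y q - x q * y p \<noteq> 0"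
    using q \<open>x p \<noteq> 0\<close> by (auto simp: field_simps)
  ultimately show thesis using that by blast
qed

lemma ci_point_coord:
  assumes "x \<in> ci_points X"
  obtains p where "p < ncoords X" "x p \<noteq> 0" "x \<in> coord_space (ncoords X)"
  using assms unfolding ci_points_def coord_space_def by (auto simp: fun_eq_iff not_less) (metis not_less)

text \<open>Linear forms already separate points and tangent vectors of projective space;
  \<open>separating_form\<close> carries this over to every positive degree.\<close>

lemma very_ample_twist_positive:
  assumes "l > 0"
  shows "very_ample_twist X l"
proof -
  define N where "N = ncoords X"
  obtain k where k: "nat l = Suc k" using assms by (metis Suc_pred' zero_less_nat_eq)
  have sec: "f \<in> twist_sections X l \<longleftrightarrow> is_form N (Suc k) f" for f
    using assms by (simp add: twist_sections_def k N_def)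
  have "\<exists>f\<in>twist_sections X l. f x \<noteq> 0" if "x \<in> ci_points X" for x
  proof -
    from that obtain p where "p < N" "x p \<noteq> 0" by (auto elim: ci_point_coord simp: N_def)
    then show ?thesis
      by (intro bexI[of _ "\<lambda>x. 1 * (x p ^ k * x p)"]) (auto simp only: sec intro: is_form_power_times_coord, simp)
  qed
  moreover have "\<exists>f\<in>twist_sections X l. f x = 0 \<and> f y \<noteq> 0"
    if "x \<in> ci_points X" "y \<in> ci_points X" and nprop: "\<nexists>c. y = (\<lambda>j. c * x j)" for x y
  proof -
    from that(1) obtain p where p: "p < N" "x p \<noteq> 0" "x \<in> coord_space N"
      by (auto elim: ci_point_coord simp: N_def)
    from that(2) obtain r where r: "r < N" "y r \<noteq> 0" "y \<in> coord_space N"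
      by (auto elim: ci_point_coord simp: N_def)
    obtain q where q: "q < N" "x p * y q - x q * y p \<noteq> 0"
      using not_proportional_minor[OF p(3) r(3) p(2) nprop] by blast
    have "separating_form r k x p q y = y r ^ k * (x p * y q - x q * y p)"
      "separating_form r k x p q x = 0"
      by (simp_all add: separating_form_def algebra_simps)
    then show ?thesis
      using p q r by (intro bexI[of _ "separating_form r k x p q"]) (auto simp: sec is_form_separating)
  qed
  moreover have "\<exists>f\<in>twist_sections X l. f x = 0 \<and> differential N f x v \<noteq> 0"
    if "x \<in> ci_points X" "v \<in> cone_tangent X x" and nprop: "\<nexists>c. v = (\<lambda>j. c * x j)" for x v
  proof -
    from that(1) obtain p where p: "p < N" "x p \<noteq> 0" "x \<in> coord_space N"
      by (auto elim: ci_point_coord simp: N_def)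
    have "v \<in> coord_space N" using that(2) by (simp add: cone_tangent_def N_def)
    from not_proportional_minor[OF p(3) this p(2) nprop]
    obtain q where q: "q < N" "x p * v q - x q * v p \<noteq> 0" .
    have "separating_form p k x p q x = 0"
      by (simp add: separating_form_def algebra_simps)
    then show ?thesis
      using p q differential_separating[OF p(1) q(1), of p k x v]
      by (intro bexI[of _ "separating_form p k x p q"]) (auto simp: sec is_form_separating)
  qed
  ultimately show ?thesis
    unfolding very_ample_twist_def N_def by blast
qed

text \<open>The \<open>n\<close> tangency equations together with \<open>v p = 0\<close> are
  \<open>n + 1\<close> equations in \<open>n + 4\<close> unknowns. As \<open>x p\<close> is nonzero,
  a multiple of \<open>x\<close> with vanishing \<open>p\<close>-th entry is zero.\<close>

lemma ci_nonproportional_tangent: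
  assumes "x \<in> ci_points X"
  obtains v where "v \<in> cone_tangent X x" "\<nexists>c. v = (\<lambda>j. c * x j)"
proof -
  define N n where "N = ncoords X" and "n = ci_codim X"
  obtain p where p: "p < N" "x p \<noteq> 0"
    using assms by (auto elim: ci_point_coord simp: N_def)
  define M where "M i j = (if i < n then partial j (ci_form X i) x else if j = p then 1 else 0)" for i j
  have "Suc n < card {..<N}" by (simp add: N_def n_def ncoords_def)
  then obtain v where v: "\<And>j. j \<notin> {..<N} \<Longrightarrow> v j = 0" "v \<noteq> (\<lambda>_. 0)"
      "\<And>i. i < Suc n \<Longrightarrow> (\<Sum>j<N. M i j * v j) = 0"
    using homogeneous_system_nontrivial[of "{..<N}" "Suc n" M] by blast
  have "v \<in> cone_tangent X x"
    unfolding cone_tangent_def coord_space_def differential_def N_def[symmetric] n_def[symmetric]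
  proof (intro CollectI conjI allI impI)
    show "v j = 0" if "N \<le> j" for j using that v(1) by simp
    show "(\<Sum>j<N. partial j (ci_form X i) x * v j) = 0" if "i < n" for i
      using v(3)[of i] that by (simp add: M_def)
  qed
  moreover have "v p = 0"
    using v(3)[of n] p(1) by (simp add: M_def if_distrib[of "\<lambda>a. a * _"] cong: if_cong)
  then have "\<nexists>c. v = (\<lambda>j. c * x j)"
    using v(2) p(2) by auto
  ultimately show thesis using that by blast
qed

text \<open>A negative twist has no sections, and the sections of the trivial twist are constants,
  whose differentials detect no tangent vector. Either failure shows at a single point.\<close>

lemma canonical_ample_iff:
  assumes "ci_points X \<noteq> {}"
  shows "canonical_ample X \<longleftrightarrow> canonical_twist X > 0"
proof
  assume "canonical_ample X"
  then obtain m where m: "m > 0" "very_ample_twist X (m * canonical_twist X)"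
    by (auto simp: canonical_ample_def ample_twist_def)
  define l where "l = m * canonical_twist X"
  obtain x where x: "x \<in> ci_points X" using assms by auto
  have "0 \<le> l"
    using m(2) x unfolding very_ample_twist_def l_def[symmetric] by (auto simp: twist_sections_def)
  moreover have "l \<noteq> 0"
  proof
    assume "l = 0"
    obtain v where "v \<in> cone_tangent X x" "\<nexists>c. v = (\<lambda>j. c * x j)"
      using ci_nonproportional_tangent[OF x] .
    then obtain f where f: "f \<in> twist_sections X 0" "f x = 0" "differential (ncoords X) f x v \<noteq> 0"
      using m(2) x unfolding very_ample_twist_def l_def[symmetric] \<open>l = 0\<close> by blast
    have "exponents N 0 = {\<lambda>_. 0}" for N
      by (auto simp: exponents_def fun_eq_iff not_less) (metis lessThan_iff not_less)
    with f(1) obtain a where "f = (\<lambda>_. a)"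
      by (auto simp: twist_sections_def is_form_def fun_eq_iff)
    with f(3) show False
      by (simp add: differential_def partial_def)
  qed
  ultimately show "canonical_twist X > 0"
    using m(1) by (auto simp: l_def zero_le_mult_iff)
next
  assume "canonical_twist X > 0"
  then show "canonical_ample X"
    unfolding canonical_ample_def ample_twist_def
    by (intro exI[of _ 1]) (simp add: very_ample_twist_positive)
qed


section \<open>Diagonal complete intersections\<close>

definition diagonal_ci :: "nat \<Rightarrow> (nat \<Rightarrow> nat) \<Rightarrow> (nat \<Rightarrow> nat \<Rightarrow> complex) \<Rightarrow> complete_intersection" where
  "diagonal_ci n e a = \<lparr>ci_codim = n, ci_deg = e, ci_form = (\<lambda>i x. \<Sum>j<n + 4. a i j * x j ^ e i)\<rparr>"

lemma diagonal_ci_simps [simp]: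
  "ci_codim (diagonal_ci n e a) = n"
  "ci_deg (diagonal_ci n e a) = e"
  "ci_form (diagonal_ci n e a) i x = (\<Sum>j<n + 4. a i j * x j ^ e i)"
  "ncoords (diagonal_ci n e a) = n + 4"
  by (simp_all add: diagonal_ci_def ncoords_def)

lemma ci_points_diagonal:
  "x \<in> ci_points (diagonal_ci n e a) \<longleftrightarrow>
    (\<forall>j\<ge>n + 4. x j = 0) \<and> (\<exists>j<n + 4. x j \<noteq> 0) \<and> (\<forall>i<n. (\<Sum>j<n + 4. a i j * x j ^ e i) = 0)"
  by (auto simp: ci_points_def coord_space_def fun_eq_iff) (metis not_less)

text \<open>The \<open>j\<close>-th partial derivatives of diagonal forms involve \<open>x j\<close>
  only, so a relation between the gradients is one equation for each coordinate.\<close>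

lemma sci_threefold_diagonal:
  assumes "n \<ge> 1" "\<And>i. i < n \<Longrightarrow> e i > 0"
    and "ci_points (diagonal_ci n e a) \<noteq> {}"
    and "\<And>x c. x \<in> ci_points (diagonal_ci n e a) \<Longrightarrow>
      (\<And>j. j < n + 4 \<Longrightarrow> (\<Sum>i<n. c i * (a i j * (of_nat (e i) * x j ^ (e i - 1)))) = 0) \<Longrightarrow>
      \<forall>i<n. c i = 0"
  shows "sci_threefold (diagonal_ci n e a)"
proof -
  have "ci_form (diagonal_ci n e a) i = (\<lambda>x. \<Sum>j<n + 4. a i j * x j ^ e i)" for i
    by (simp add: fun_eq_iff)
  then show ?thesis
    unfolding sci_threefold_def using assms
    by (auto simp: partial_diagonal Suc_le_eq intro: is_form_diagonal)
qed

lemma complex_root_exists: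
  assumes "e > 0"
  obtains w :: complex where "w ^ e = z"
proof (cases "z = 0")
  case True
  then show ?thesis using that[of 0] assms by simp
next
  case False
  then have "exp (Ln z / of_nat e) ^ e = z"
    using assms by (simp flip: exp_of_nat_mult)
  then show ?thesis using that by blast
qed

section \<open>Intersections of hypersurfaces of equal degree\<close>

definition vandermonde_ci :: "nat \<Rightarrow> nat \<Rightarrow> complete_intersection" where
  "vandermonde_ci n e = diagonal_ci n (\<lambda>_. e) (\<lambda>i j. of_nat j ^ i)"

text \<open>Combining the equations with the coefficients of a polynomial \<open>r\<close> of degree
  below \<open>n\<close> shows that the sum of the \<open>r(j) * y j\<close> is 0. If
  \<open>card S <= n\<close>, such an \<open>r\<close> can vanish at all nodes of \<open>S\<close>
  except one, which isolates a nonzero term.\<close>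

lemma vandermonde_support:
  fixes y :: "nat \<Rightarrow> complex"
  assumes "finite S" "S \<noteq> {}" "\<And>j. j \<in> S \<Longrightarrow> y j \<noteq> 0"
    and zero: "\<And>i. i < n \<Longrightarrow> (\<Sum>j\<in>S. of_nat j ^ i * y j) = 0"
  shows "n < card S"
proof (rule ccontr)
  assume "\<not> n < card S"
  obtain s where s: "s \<in> S" using assms(2) by blast
  define r :: "complex poly" where "r = (\<Prod>j\<in>S - {s}. [:- of_nat j, 1:])"
  have "degree r = card S - 1"
    unfolding r_def using s assms(1) by (subst degree_prod_sum_eq) auto
  then have deg: "degree r < n"
    using \<open>\<not> n < card S\<close> s assms(1) by (metis One_nat_def card_gt_0_iff assms(2) diff_less leI le_less_trans less_numeral_extra(1) not_less_eq_eq order_less_le_trans linorder_neqE_nat)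
  have "(\<Sum>j\<in>S. poly r (of_nat j) * y j) = (\<Sum>i\<le>degree r. coeff r i * (\<Sum>j\<in>S. of_nat j ^ i * y j))"
    unfolding poly_altdef sum_distrib_left sum_distrib_right
    by (subst sum.swap) (simp add: mult_ac)
  also have "\<dots> = 0"
    using deg zero by (intro sum.neutral) auto
  also have "(\<Sum>j\<in>S. poly r (of_nat j) * y j) = poly r (of_nat s) * y s"
  proof -
    have "poly r (of_nat j) = 0" if "j \<in> S - {s}" for j
      using that assms(1) by (auto simp: r_def poly_prod)
    then show ?thesis
      using s assms(1) by (subst sum.remove[of _ s]) auto
  qed
  finally have "poly r (of_nat s) = 0"
    using assms(3) s by simp
  then show False
    using assms(1) by (auto simp: r_def poly_prod)
qed

text \<open>The powers \<open>x j ^ e\<close> form a kernel vector of a Vandermonde matrix, so more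
  than \<open>n\<close> coordinates are nonzero. A relation between the gradients makes the
  polynomial with coefficients \<open>c i\<close>, of degree below \<open>n\<close>, vanish at all
  their indices.\<close>

lemma sci_threefold_vandermonde:
  assumes "n \<ge> 1" "e \<ge> 1"
  shows "sci_threefold (vandermonde_ci n e)"
  unfolding vandermonde_ci_def
proof (rule sci_threefold_diagonal)
  show "ci_points (diagonal_ci n (\<lambda>_. e) (\<lambda>i j. of_nat j ^ i)) \<noteq> {}"
  proof -
    have "n < card {..<n + 4}" by simp
    then obtain y where y: "\<And>j. j \<notin> {..<n + 4} \<Longrightarrow> y j = 0" "y \<noteq> (\<lambda>_. 0)"
      "\<And>i. i < n \<Longrightarrow> (\<Sum>j<n + 4. of_nat j ^ i * y j) = (0::complex)"
      using homogeneous_system_nontrivial[of "{..<n + 4}" n "\<lambda>i j. of_nat j ^ i"] by blast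
    have "\<forall>j. \<exists>w. w ^ e = y j"
      using assms(2) complex_root_exists[of e] by (metis less_eq_Suc_le One_nat_def)
    then obtain x where x: "\<And>j. x j ^ e = y j" by metis
    have "x j = 0 \<longleftrightarrow> y j = 0" for j
      using x[of j] assms(2) by (metis power_eq_0_iff not_one_le_zero neq0_conv)
    moreover obtain j where "y j \<noteq> 0" using y(2) by auto
    ultimately have "x \<in> ci_points (diagonal_ci n (\<lambda>_. e) (\<lambda>i j. of_nat j ^ i))"
      unfolding ci_points_diagonal x using y by (auto intro: exI[of _ j] simp: not_less) (metis not_less)
    then show ?thesis by blast
  qed
next
  fix x c :: "nat \<Rightarrow> complex"
  assume "x \<in> ci_points (diagonal_ci n (\<lambda>_. e) (\<lambda>i j. of_nat j ^ i))"
  then have x: "\<exists>j<n + 4. x j \<noteq> 0" "\<And>i. i < n \<Longrightarrow> (\<Sum>j<n + 4. of_nat j ^ i * x j ^ e) = 0"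
    unfolding ci_points_diagonal by auto
  assume lin: "\<And>j. j < n + 4 \<Longrightarrow> (\<Sum>i<n. c i * (of_nat j ^ i * (of_nat e * x j ^ (e - 1)))) = 0"
  define S where "S = {j. j < n + 4 \<and> x j \<noteq> 0}"
  have "finite S" by (simp add: S_def)
  have "(\<Sum>j\<in>S. of_nat j ^ i * x j ^ e) = (\<Sum>j<n + 4. of_nat j ^ i * x j ^ e)" for i
    using assms(2) by (intro sum.mono_neutral_left) (auto simp: S_def)
  then have "n < card S"
    using x by (intro vandermonde_support[where y = "\<lambda>j. x j ^ e"]) (auto simp: S_def)
  define p where "p = (\<Sum>i<n. monom (c i) i)"
  have coeff_p: "coeff p i = (if i < n then c i else 0)" for i
    by (simp add: p_def coeff_sum)
  have "poly p (of_nat j) = 0" if "j \<in> S" for j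
  proof -
    have "(\<Sum>i<n. c i * of_nat j ^ i) * (of_nat e * x j ^ (e - 1)) = 0"
      using lin[of j] that by (simp only: S_def sum_distrib_right mult.assoc mem_Collect_eq)
    then show ?thesis
      using that assms(2) by (simp add: S_def p_def poly_sum poly_monom)
  qed
  then have sub: "of_nat ` S \<subseteq> {z. poly p z = 0}" by auto
  have "p = 0"
  proof (rule ccontr)
    assume "p \<noteq> 0"
    have "card S = card (of_nat ` S :: complex set)"
      by (simp add: card_image inj_on_def)
    also have "\<dots> \<le> card {z. poly p z = 0}"
      using sub poly_roots_finite[OF \<open>p \<noteq> 0\<close>] by (rule card_mono[rotated])
    also have "\<dots> \<le> degree p" using \<open>p \<noteq> 0\<close> by (rule card_poly_roots_bound)
    also have "\<dots> \<le> n" by (rule degree_le) (simp add: coeff_p)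
    finally show False using \<open>n < card S\<close> by simp
  qed
  then show "\<forall>i<n. c i = 0"
    using coeff_p by (metis coeff_0)
qed (use assms in auto)

section \<open>Intersections of mixed degrees\<close>

definition quartic_cubic_ci :: complete_intersection where
  "quartic_cubic_ci = diagonal_ci 2 (\<lambda>i. if i = 0 then 4 else 3) (\<lambda>_ _. 1)"

text \<open>At a singular point all nonzero coordinates solve
  \<open>4 * c 0 * x j = - 3 * c 1\<close>. If \<open>c 0\<close> is nonzero, they equal one number
  \<open>k\<close>, and the quartic takes the nonzero value \<open>card S * k ^ 4\<close>; otherwise
  any of them gives \<open>c 1 = 0\<close>.\<close>

lemma sci_threefold_quartic_cubic: "sci_threefold quartic_cubic_ci"
  unfolding quartic_cubic_ci_def
proof (rule sci_threefold_diagonal)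
  \<comment> \<open>In \<open>(1, -1, z, -z, 0, 0)\<close> the cubes cancel in pairs, and the fourth
    powers are 1, 1, -1, -1.\<close>
  obtain z :: complex where z: "z ^ 4 = - 1" using complex_root_exists[of 4 "-1"] by auto
  define x :: "nat \<Rightarrow> complex" where "x = (\<lambda>_. 0)(0 := 1, 1 := - 1, 2 := z, 3 := - z)"
  have "x \<in> ci_points (diagonal_ci 2 (\<lambda>i. if i = 0 then 4 else 3) (\<lambda>_ _. 1))"
    unfolding ci_points_diagonal
    using z by (auto simp: x_def less_2_cases_iff eval_nat_numeral intro!: exI[of _ 0])
  then show "ci_points (diagonal_ci 2 (\<lambda>i. if i = 0 then 4 else 3) (\<lambda>_ _. 1)) \<noteq> {}"
    by blast
next
  fix x c :: "nat \<Rightarrow> complex"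
  assume "x \<in> ci_points (diagonal_ci 2 (\<lambda>i. if i = 0 then 4 else 3) (\<lambda>_ _. 1))"
  then have x: "\<exists>j<6. x j \<noteq> 0" "(\<Sum>j<6. x j ^ 4) = 0"
    unfolding ci_points_diagonal by (auto dest: spec[of _ 0])
  assume lin: "\<And>j. j < 2 + 4 \<Longrightarrow> (\<Sum>i<2. c i * (1 * (of_nat (if i = 0 then 4 else 3)
      * x j ^ ((if i = 0 then 4 else 3) - 1)))) = 0"
  have "x j = 0 \<or> 4 * c 0 * x j = - 3 * c 1" if "j < 6" for j
  proof -
    have "x j ^ 2 * (4 * c 0 * x j + 3 * c 1) = 0"
      using lin[of j] that by (simp add: numeral_2_eq_2 power3_eq_cube power2_eq_square algebra_simps)
    then show ?thesis by (auto simp: add_eq_0_iff)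
  qed
  note alt = this
  have "c 0 = 0"
  proof (rule ccontr)
    assume "c 0 \<noteq> 0"
    define S where "S = {j. j < 6 \<and> x j \<noteq> 0}"
    define k where "k = - 3 * c 1 / (4 * c 0)"
    have k: "x j = k" if "j \<in> S" for j
      using alt[of j] that \<open>c 0 \<noteq> 0\<close> by (auto simp: S_def k_def field_simps)
    have "(\<Sum>j<6. x j ^ 4) = (\<Sum>j\<in>S. x j ^ 4)"
      by (intro sum.mono_neutral_right) (auto simp: S_def)
    also have "\<dots> = of_nat (card S) * k ^ 4"
      using k by simp
    finally have *: "card S = 0 \<or> k = 0" using x(2) by simp
    obtain j where j: "j \<in> S" using x(1) by (auto simp: S_def)
    have "finite S" by (simp add: S_def)
    then have "card S \<noteq> 0" using j by auto
    with * have "x j = 0" using k[OF j] by simp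
    then show False using j by (simp add: S_def)
  qed
  moreover have "c 1 = 0"
    using alt x(1) \<open>c 0 = 0\<close> by auto
  ultimately show "\<forall>i<2. c i = 0" by (simp add: less_2_cases_iff)
qed auto

text \<open>Clearing denominators gives a polynomial \<open>p\<close>. It is not zero, because at
  the pole \<open>- of_nat g\<close> every term except that of \<open>g\<close> vanishes.\<close>

lemma finite_zeros_cubic_partial_fractions:
  fixes c :: "nat \<Rightarrow> complex"
  assumes "finite G" "G \<noteq> {}" "\<And>g. g \<in> G \<Longrightarrow> c g \<noteq> 0"
  shows "finite {t. (\<forall>g\<in>G. t + of_nat g \<noteq> 0) \<and> (\<Sum>g\<in>G. c g / (t + of_nat g) ^ 3) = 0}"
proof -
  define p where "p = (\<Sum>g\<in>G. smult (c g) (\<Prod>h\<in>G - {g}. [:of_nat h, 1:] ^ 3))"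
  have poly_p: "poly p t = (\<Sum>g\<in>G. c g * (\<Prod>h\<in>G - {g}. (t + of_nat h) ^ 3))" for t
    by (simp add: p_def poly_sum poly_prod add.commute)
  obtain g where g: "g \<in> G" using assms(2) by blast
  have "poly p (- of_nat g) = c g * (\<Prod>h\<in>G - {g}. (- of_nat g + of_nat h) ^ 3)"
    unfolding poly_p using g assms(1)
    by (subst sum.remove[of _ g]) (auto intro!: sum.neutral prod_zero)
  also have "\<dots> \<noteq> 0"
    using assms g by auto
  finally have "p \<noteq> 0" by auto
  have "poly p t = 0" if "\<forall>g\<in>G. t + of_nat g \<noteq> 0" "(\<Sum>g\<in>G. c g / (t + of_nat g) ^ 3) = 0" for t
  proof -
    have "c g * (\<Prod>h\<in>G - {g}. (t + of_nat h) ^ 3) = (\<Prod>h\<in>G. (t + of_nat h) ^ 3) * (c g / (t + of_nat g) ^ 3)"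
      if "g \<in> G" for g
      using that \<open>\<forall>g\<in>G. t + of_nat g \<noteq> 0\<close> assms(1) by (subst prod.remove[of G g]) auto
    then have "poly p t = (\<Prod>h\<in>G. (t + of_nat h) ^ 3) * (\<Sum>g\<in>G. c g / (t + of_nat g) ^ 3)"
      unfolding poly_p sum_distrib_left by (rule sum.cong[OF refl])
    then show ?thesis using that(2) by simp
  qed
  then show ?thesis
    using poly_roots_finite[OF \<open>p \<noteq> 0\<close>] by (auto elim: finite_subset[rotated])
qed

text \<open>Weights are chosen one after the other: eliminating the last term from the two equations leaves
  finitely many \<open>t\<close>, and each of them excludes a single value of the last weight.\<close>

lemma generic_weights:
  "\<exists>w :: nat \<Rightarrow> real. (\<forall>g. w g > 0) \<and>
     (\<forall>m t. (\<forall>g<k. m g \<le> (2::nat)) \<longrightarrow> (\<exists>g<k. m g \<noteq> 0) \<longrightarrow>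
        (\<forall>g<k. m g \<noteq> 0 \<longrightarrow> t + of_nat g \<noteq> (0::complex)) \<longrightarrow>
        (\<Sum>g<k. of_nat (m g) * of_real (w g) / (t + of_nat g) ^ 3) = 0 \<longrightarrow>
        (\<Sum>g<k. of_nat (m g) * of_real (w g) * of_nat g / (t + of_nat g) ^ 3) \<noteq> 0)"
proof (induction k)
  case 0
  show ?case by (intro exI[of _ "\<lambda>_. 1"]) auto
next
  case (Suc k)
  define S where "S w m l t = (\<Sum>g<l. of_nat (m g) * complex_of_real (w g) / (t + of_nat g) ^ 3)"
    for w :: "nat \<Rightarrow> real" and m :: "nat \<Rightarrow> nat" and l t
  define S' where "S' w m l t = (\<Sum>g<l. of_nat (m g) * complex_of_real (w g) * of_nat g / (t + of_nat g) ^ 3)"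
    for w :: "nat \<Rightarrow> real" and m :: "nat \<Rightarrow> nat" and l t
  from Suc.IH obtain w where w: "\<And>g. w g > 0"
    and IH: "\<And>m t. \<lbrakk>\<forall>g<k. m g \<le> 2; \<exists>g<k. m g \<noteq> 0; \<forall>g<k. m g \<noteq> 0 \<longrightarrow> t + of_nat g \<noteq> 0;
        S w m k t = 0\<rbrakk> \<Longrightarrow> S' w m k t \<noteq> 0"
    unfolding S_def S'_def by blast
  \<comment> \<open>The set of multiplicity patterns is finite because entries with index above
    \<open>k\<close> are fixed to be 0.\<close>
  define M where "M = {m. \<forall>g. (g \<in> {..<Suc k} \<longrightarrow> m g \<in> {..2::nat}) \<and> (g \<notin> {..<Suc k} \<longrightarrow> m g = 0)}"
  have "finite M"
    unfolding M_def by (rule finite_set_of_finite_funs) auto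
  \<comment> \<open>The combination \<open>S' - k * S\<close> has no term at \<open>g = k\<close>,
    and its coefficients \<open>g - k\<close> are nonzero for \<open>g < k\<close>.\<close>
  define T where "T m = {t::complex. (\<forall>g\<in>{g. g < k \<and> m g \<noteq> 0}. t + of_nat g \<noteq> 0) \<and>
      (\<Sum>g\<in>{g. g < k \<and> m g \<noteq> 0}. of_nat (m g) * of_real (w g) * (of_nat g - of_nat k) / (t + of_nat g) ^ 3) = 0}"
    for m
  have "finite (T m)" if "\<exists>g<k. m g \<noteq> 0" for m
    unfolding T_def
  proof (rule finite_zeros_cubic_partial_fractions)
    fix g assume "g \<in> {g. g < k \<and> m g \<noteq> 0}"
    then show "of_nat (m g) * of_real (w g) * (of_nat g - of_nat k) \<noteq> (0::complex)"
      using w[of g] by simp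
  qed (use that in auto)
  \<comment> \<open>For given \<open>m\<close> and \<open>t\<close> this is the last weight that
    solves \<open>S = 0\<close>. For \<open>m k = 0\<close> the quotient is 0 by convention, which
    only adds a value to a finite set.\<close>
  define bad where "bad = (\<Union>m\<in>{m \<in> M. \<exists>g<k. m g \<noteq> 0}.
      (\<lambda>t. - S w m k t * (t + of_nat k) ^ 3 / of_nat (m k)) ` T m)"
  have "finite bad"
    unfolding bad_def using \<open>finite M\<close> \<open>\<And>m. \<exists>g<k. m g \<noteq> 0 \<Longrightarrow> finite (T m)\<close> by auto
  then have "finite {u. complex_of_real u \<in> bad}"
    by (intro finite_vimageI[of bad complex_of_real, unfolded vimage_def]) (auto simp: inj_on_def)
  then have "infinite ({0<..} - {u. complex_of_real u \<in> bad})"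
    using infinite_Ioi[of "0::real"] by (rule Diff_infinite_finite)
  then obtain u where u: "u > 0" "complex_of_real u \<notin> bad"
    using infinite_imp_nonempty by blast
  define v where "v = w(k := u)"
  have S_v: "S v m k t = S w m k t" "S' v m k t = S' w m k t" for m t
    by (auto simp: S_def S'_def v_def intro!: sum.cong)
  have S_Suc: "S v m (Suc k) t = S w m k t + of_nat (m k) * complex_of_real u / (t + of_nat k) ^ 3"
    "S' v m (Suc k) t = S' w m k t + of_nat (m k) * complex_of_real u * of_nat k / (t + of_nat k) ^ 3" for m t
    using S_v[of m t] by (simp_all add: S_def S'_def v_def)
  have "S' v m (Suc k) t \<noteq> 0"
    if m: "\<forall>g<Suc k. m g \<le> 2" "\<exists>g<Suc k. m g \<noteq> 0"
      and t: "\<forall>g<Suc k. m g \<noteq> 0 \<longrightarrow> t + of_nat g \<noteq> 0" and zero: "S v m (Suc k) t = 0" for m t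
  proof
    assume zero': "S' v m (Suc k) t = 0"
    show False
    proof (cases "m k = 0")
      case True
      then have "S w m k t = 0" "S' w m k t = 0"
        using zero zero' by (simp_all add: S_Suc)
      moreover have "\<exists>g<k. m g \<noteq> 0"
        using True m(2) by (auto simp: less_Suc_eq)
      ultimately show False using IH[of m t] m(1) t by auto
    next
      case False
      then have tk: "t + of_nat k \<noteq> 0" using t by auto
      show False
      proof (cases "\<exists>g<k. m g \<noteq> 0")
        case True
        define m' where "m' = (\<lambda>g. if g < Suc k then m g else 0)"
        have "m' \<in> {m \<in> M. \<exists>g<k. m g \<noteq> 0}"
          using m True by (auto simp: M_def m'_def)
        moreover have "t \<in> T m'"
        proof -
          have "S' w m k t - of_nat k * S w m k t = 0"
          proof -
            have "S w m k t = - (of_nat (m k) * complex_of_real u / (t + of_nat k) ^ 3)"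
              "S' w m k t = - (of_nat (m k) * complex_of_real u * of_nat k / (t + of_nat k) ^ 3)"
              using zero zero' unfolding S_Suc by (simp_all only: eq_neg_iff_add_eq_0)
            then show ?thesis by simp
          qed
          also have "S' w m k t - of_nat k * S w m k t
              = (\<Sum>g<k. of_nat (m g) * of_real (w g) * (of_nat g - of_nat k) / (t + of_nat g) ^ 3)"
            unfolding S_def S'_def sum_distrib_left sum_subtractf[symmetric]
            by (intro sum.cong) (auto simp: diff_divide_distrib[symmetric] algebra_simps)
          also have "\<dots> = (\<Sum>g\<in>{g. g < k \<and> m g \<noteq> 0}.
              of_nat (m g) * of_real (w g) * (of_nat g - of_nat k) / (t + of_nat g) ^ 3)"
            by (intro sum.mono_neutral_right) auto
          finally show ?thesis
            using t by (auto simp: T_def m'_def cong: conj_cong)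
        qed
        moreover have "complex_of_real u = - S w m' k t * (t + of_nat k) ^ 3 / of_nat (m' k)"
        proof -
          have "S w m' k t = S w m k t" by (auto simp: S_def m'_def intro!: sum.cong)
          then show ?thesis
            using zero False tk unfolding S_Suc by (simp add: m'_def field_simps add_eq_0_iff)
        qed
        ultimately have "complex_of_real u \<in> bad" unfolding bad_def by blast
        with u(2) show False by contradiction
      next
        \<comment> \<open>Only the last group occurs, so \<open>S\<close> is a single nonzero
          term.\<close>
        case none: False
        then have "S w m k t = 0" by (simp add: S_def)
        then show False
          using zero False tk u(1) unfolding S_Suc by simp
      qed
    qed
  qed
  moreover have "v g > 0" for g using w u by (simp add: v_def)
  ultimately show ?case unfolding S_def S'_def by blast
qed

text \<open>The groups \<open>j div 2\<close> are three pairs and the single coordinate 6. All three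
  forms carry the same weight on a group, so the weight cancels from the gradient equations and
  affects only the equations of the points.\<close>

definition paired_cubics_quadric_ci :: "(nat \<Rightarrow> real) \<Rightarrow> complete_intersection" where
  "paired_cubics_quadric_ci w = diagonal_ci 3 (\<lambda>i. if i = 2 then 2 else 3)
     (\<lambda>i j. of_real (w (j div 2)) * (if i = 1 then of_nat (j div 2) else 1))"

lemma sum_lessThan_3: "sum f {..<3::nat} = f 0 + f 1 + f 2"
  by (simp add: eval_nat_numeral)

text \<open>Coordinates with the same coefficients come in pairs, so that a point with vanishing cubes
  is given by \<open>(u, -u, v, -v, 0, 0, 0)\<close>.  At a singular point with nonzero multiplier \<open>c 2\<close> of the
  quadric, the nonzero coordinates are the values of \<open>-2 (c 2) / (3 (c 0 + c 1 g))\<close>, which the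
  choice of the weights excludes.\<close>

lemma sci_threefold_cubics_quadric: "\<exists>w. sci_threefold (paired_cubics_quadric_ci w)"
proof -
  obtain w :: "nat \<Rightarrow> real" where w: "\<And>g. w g > 0"
    and generic: "\<And>m t. \<lbrakk>\<forall>g<4. m g \<le> (2::nat); \<exists>g<4. m g \<noteq> 0; \<forall>g<4. m g \<noteq> 0 \<longrightarrow> t + of_nat g \<noteq> 0;
        (\<Sum>g<4. of_nat (m g) * complex_of_real (w g) / (t + of_nat g) ^ 3) = 0;
        (\<Sum>g<4. of_nat (m g) * complex_of_real (w g) * of_nat g / (t + of_nat g) ^ 3) = 0\<rbrakk> \<Longrightarrow> False"
    using generic_weights[of 4] by blast
  let ?e = "\<lambda>i::nat. if i = 2 then 2 else 3 :: nat"
  let ?a = "\<lambda>(i::nat) j. complex_of_real (w (j div 2)) * (if i = 1 then of_nat (j div 2) else 1)"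
  have "sci_threefold (diagonal_ci 3 ?e ?a)"
  proof (rule sci_threefold_diagonal)
    \<comment> \<open>With these square roots the quadric becomes
      \<open>2 * w 0 * w 1 - 2 * w 1 * w 0\<close>.\<close>
    define x :: "nat \<Rightarrow> complex" where
      "x = (\<lambda>_. 0)(0 := of_real (sqrt (w 1)), 1 := - of_real (sqrt (w 1)),
                   2 := \<i> * of_real (sqrt (w 0)), 3 := - (\<i> * of_real (sqrt (w 0))))"
    have sq: "complex_of_real (sqrt (w g)) ^ 2 = w g" for g
      using w[of g] by (simp flip: of_real_power)
    have expand: "(\<Sum>j<3 + 4. f j) = f 0 + f 1 + f 2 + f 3 + f 4 + f 5 + f (6::nat)" for f :: "nat \<Rightarrow> complex"
      by (simp add: eval_nat_numeral)
    have "x \<in> ci_points (diagonal_ci 3 ?e ?a)"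
      unfolding ci_points_diagonal expand
    proof (intro conjI allI impI)
      show "\<exists>j<3 + 4. x j \<noteq> 0"
        using w[of 1] by (intro exI[of _ 0]) (simp add: x_def)
      fix i :: nat assume "i < 3"
      then consider "i = 0" | "i = 1" | "i = 2" by linarith
      then show "?a i 0 * x 0 ^ ?e i + ?a i 1 * x 1 ^ ?e i + ?a i 2 * x 2 ^ ?e i + ?a i 3 * x 3 ^ ?e i
        + ?a i 4 * x 4 ^ ?e i + ?a i 5 * x 5 ^ ?e i + ?a i 6 * x 6 ^ ?e i = 0"
        by cases (simp_all add: x_def power_mult_distrib sq)
    qed (simp add: x_def)
    then show "ci_points (diagonal_ci 3 ?e ?a) \<noteq> {}" by blast
  next
    fix x c :: "nat \<Rightarrow> complex"
    assume "x \<in> ci_points (diagonal_ci 3 ?e ?a)"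
    then have x: "\<exists>j<7. x j \<noteq> 0" "\<And>i. i < 3 \<Longrightarrow> (\<Sum>j<7. ?a i j * x j ^ ?e i) = 0"
      unfolding ci_points_diagonal by auto
    have cubics: "(\<Sum>j<7. w (j div 2) * x j ^ 3) = 0" "(\<Sum>j<7. w (j div 2) * of_nat (j div 2) * x j ^ 3) = 0"
      and quadric: "(\<Sum>j<7. w (j div 2) * x j ^ 2) = 0"
      using x(2)[of 0] x(2)[of 1] x(2)[of 2] by simp_all
    assume lin: "\<And>j. j < 3 + 4 \<Longrightarrow> (\<Sum>i<3. c i * (?a i j * (of_nat (?e i) * x j ^ (?e i - 1)))) = 0"
    have alt: "3 * (c 0 + c 1 * of_nat (j div 2)) * x j = - 2 * c 2" if "j < 7" "x j \<noteq> 0" for j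
    proof -
      have "w (j div 2) * x j * (3 * (c 0 + c 1 * of_nat (j div 2)) * x j + 2 * c 2) = 0"
        using lin[of j] that(1) by (simp add: sum_lessThan_3 power2_eq_square algebra_simps)
      then show ?thesis
        using that(2) w[of "j div 2"] by (simp add: add_eq_0_iff)
    qed
    define S where "S = {j. j < 7 \<and> x j \<noteq> 0}"
    have "finite S" by (simp add: S_def)
    have sum_S: "(\<Sum>j\<in>S. f j * x j ^ k) = (\<Sum>j<7. f j * x j ^ k)" if "k > 0" for f k
      using that by (intro sum.mono_neutral_left) (auto simp: S_def)
    show "\<forall>i<3. c i = 0"
    proof (rule ccontr)
      assume nz: "\<not> (\<forall>i<3. c i = 0)"
      show False
      proof (cases "c 2 = 0")
        \<comment> \<open>Now \<open>c 0 + c 1 * g\<close> vanishes on the group of every nonzero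
          coordinate, so only one group occurs.\<close>
        case True
        obtain l where l: "l \<in> S" using x(1) by (auto simp: S_def)
        have root: "c 0 + c 1 * of_nat (j div 2) = 0" if "j \<in> S" for j
          using alt[of j] that True by (simp add: S_def del: distrib_left_numeral)
        have "c 1 \<noteq> 0"
        proof
          assume "c 1 = 0"
          then have "c 0 = 0" using root[OF l] by simp
          with \<open>c 1 = 0\<close> True nz show False by (auto simp: less_Suc_eq numeral_3_eq_3 numeral_2_eq_2)
        qed
        have "j div 2 = l div 2" if "j \<in> S" for j
        proof -
          have "c 1 * of_nat (j div 2) = c 1 * of_nat (l div 2)"
            using root[OF that] root[OF l] by (metis add_left_imp_eq)
          then show ?thesis using \<open>c 1 \<noteq> 0\<close> by (metis mult_left_cancel of_nat_eq_iff)
        qed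
        then have sub: "S \<subseteq> {2 * (l div 2), Suc (2 * (l div 2))}"
          by (auto) (metis div_mult_mod_eq mult.commute add.right_neutral add_Suc_right mod2_eq_if One_nat_def)+
        define g where "g = l div 2"
        \<comment> \<open>The group of coordinate 6 has no second member; index 7 is filled with
          0.\<close>
        define y z where "y = (if 2 * g < 7 then x (2 * g) else 0)"
          and "z = (if Suc (2 * g) < 7 then x (Suc (2 * g)) else 0)"
        have pair: "(\<Sum>j<7. w (j div 2) * x j ^ k) = w g * (y ^ k + z ^ k)" if "k > 0" for k
        proof -
          have "(\<Sum>j<7. w (j div 2) * x j ^ k) = (\<Sum>j\<in>S. w (j div 2) * x j ^ k)"
            using sum_S[OF that] by simp
          also have "\<dots> = (\<Sum>j\<in>{2 * g, Suc (2 * g)}. w (j div 2) * (if j < 7 then x j else 0) ^ k)"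
            using sub that by (intro sum.mono_neutral_cong_left) (auto simp: S_def g_def)
          also have "\<dots> = w g * (y ^ k + z ^ k)"
            by (simp add: y_def z_def algebra_simps)
          finally show ?thesis .
        qed
        have eq3: "y ^ 3 + z ^ 3 = 0" and eq2: "y ^ 2 + z ^ 2 = 0"
          using pair[of 3] pair[of 2] cubics(1) quadric w[of g] by simp_all
        \<comment> \<open>The cubes give \<open>y ^ 6 = z ^ 6\<close>, the squares give
          \<open>y ^ 6 = - z ^ 6\<close>.\<close>
        have "2 * y ^ 6 = 0" using eq2 eq3 by algebra
        moreover have "2 * z ^ 6 = 0" using eq2 eq3 by algebra
        ultimately have "y = 0" "z = 0" by simp_all
        then show False using l sub by (auto simp: S_def y_def z_def g_def split: if_splits)
      next
        case False
        define K where "K = - 2 * c 2 / 3"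
        have K: "(c 0 + c 1 * of_nat (j div 2)) * x j = K" if "j \<in> S" for j
          using alt[of j] that by (simp add: S_def K_def field_simps)
        have "K \<noteq> 0" using False by (simp add: K_def)
        define m where "m g = card {j \<in> S. j div 2 = g}" for g
        have m2: "m g \<le> 2" for g
        proof -
          have "{j \<in> S. j div 2 = g} \<subseteq> {2 * g, Suc (2 * g)}" by auto
          then have "m g \<le> card {2 * g, Suc (2 * g)}" unfolding m_def by (intro card_mono) auto
          then show ?thesis by simp
        qed
        obtain l where l: "l \<in> S" using x(1) by (auto simp: S_def)
        then have "m (l div 2) \<noteq> 0" "l div 2 < 4"
          using \<open>finite S\<close> by (auto simp: m_def S_def)
        then have m_nz: "\<exists>g<4. m g \<noteq> 0" by blast
        have group: "(\<Sum>j\<in>S. f (j div 2)) = (\<Sum>g<4. of_nat (m g) * f g)" for f :: "nat \<Rightarrow> complex"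
        proof -
          have "(\<Sum>j\<in>S. f (j div 2)) = (\<Sum>g<4. \<Sum>j\<in>{j \<in> S. j div 2 = g}. f (j div 2))"
            using \<open>finite S\<close> by (intro sum.group[symmetric]) (auto simp: S_def)
          also have "\<dots> = (\<Sum>g<4. of_nat (m g) * f g)"
            by (intro sum.cong) (auto simp: m_def)
          finally show ?thesis .
        qed
        show False
        proof (cases "c 1 = 0")
          \<comment> \<open>All nonzero coordinates coincide, so the first cubic is a positive sum
            of weights times a nonzero cube.\<close>
          case True
          then have "c 0 \<noteq> 0" using K[OF l] \<open>K \<noteq> 0\<close> by auto
          have "(\<Sum>j\<in>S. w (j div 2) * x j ^ 3) = (\<Sum>j\<in>S. w (j div 2) * (K / c 0) ^ 3)"
          proof (intro sum.cong refl)
            fix j assume "j \<in> S"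
            then have "x j = K / c 0" using K True \<open>c 0 \<noteq> 0\<close> by (auto simp: field_simps)
            then show "w (j div 2) * x j ^ 3 = w (j div 2) * (K / c 0) ^ 3" by simp
          qed
          also have "\<dots> = of_real (\<Sum>j\<in>S. w (j div 2)) * (K / c 0) ^ 3"
            by (simp add: sum_distrib_right)
          finally have "of_real (\<Sum>j\<in>S. w (j div 2)) * (K / c 0) ^ 3 = 0"
            using cubics(1) sum_S[of 3] by simp
          then have "(\<Sum>j\<in>S. w (j div 2)) = 0"
            using \<open>K \<noteq> 0\<close> \<open>c 0 \<noteq> 0\<close> by (simp del: of_real_sum)
          moreover have "(\<Sum>j\<in>S. w (j div 2)) > 0"
            using \<open>finite S\<close> l w by (intro sum_pos) auto
          ultimately show False by simp
        next
          case c1: False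
          \<comment> \<open>The nonzero coordinates are \<open>(K / c 1) / (t + g)\<close>, and the
            two cubics become the sums in \<open>generic\<close>, with \<open>m g\<close> counting
            the nonzero coordinates of group \<open>g\<close>.\<close>
          define t where "t = c 0 / c 1"
          have nz: "t + of_nat (j div 2) \<noteq> 0" and xj: "x j = K / c 1 / (t + of_nat (j div 2))"
            if "j \<in> S" for j
          proof -
            have *: "(t + of_nat (j div 2)) * x j = K / c 1"
              using K[OF that] c1 by (simp add: t_def field_simps)
            then show nz: "t + of_nat (j div 2) \<noteq> 0" using \<open>K \<noteq> 0\<close> c1 by auto
            show "x j = K / c 1 / (t + of_nat (j div 2))"
              using * nz by (metis nonzero_mult_div_cancel_left)
          qed
          have eq: "(\<Sum>j\<in>S. f (j div 2) * x j ^ 3) = (K / c 1) ^ 3 * (\<Sum>g<4. of_nat (m g) * (f g / (t + of_nat g) ^ 3))"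
            for f :: "nat \<Rightarrow> complex"
          proof -
            have "(\<Sum>j\<in>S. f (j div 2) * x j ^ 3) = (\<Sum>j\<in>S. (K / c 1) ^ 3 * (f (j div 2) / (t + of_nat (j div 2)) ^ 3))"
              using xj by (intro sum.cong) (auto simp: power_divide power_mult_distrib)
            also have "\<dots> = (K / c 1) ^ 3 * (\<Sum>j\<in>S. f (j div 2) / (t + of_nat (j div 2)) ^ 3)"
              by (simp add: sum_distrib_left)
            also have "(\<Sum>j\<in>S. f (j div 2) / (t + of_nat (j div 2)) ^ 3)
                = (\<Sum>g<4. of_nat (m g) * (f g / (t + of_nat g) ^ 3))"
              by (rule group[of "\<lambda>g. f g / (t + of_nat g) ^ 3"])
            finally show ?thesis .
          qed
          show False
          proof (rule generic[of m t])
            show "\<forall>g<4. m g \<noteq> 0 \<longrightarrow> t + of_nat g \<noteq> 0"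
            proof (intro allI impI)
              fix g assume "m g \<noteq> 0"
              then obtain j where "j \<in> S" "j div 2 = g" unfolding m_def by (metis (mono_tags, lifting) card.empty empty_Collect_eq)
              then show "t + of_nat g \<noteq> 0" using nz by blast
            qed
            show "(\<Sum>g<4. of_nat (m g) * complex_of_real (w g) / (t + of_nat g) ^ 3) = 0"
              using eq[of "\<lambda>g. of_real (w g)"] sum_S[of 3] cubics(1) \<open>K \<noteq> 0\<close> c1 by simp
            show "(\<Sum>g<4. of_nat (m g) * complex_of_real (w g) * of_nat g / (t + of_nat g) ^ 3) = 0"
            proof -
              have "(\<Sum>j\<in>S. of_real (w (j div 2)) * of_nat (j div 2) * x j ^ 3) = 0"
                using cubics(2) sum_S[of 3 "\<lambda>j. of_real (w (j div 2)) * of_nat (j div 2)"] by simp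
              then have "(\<Sum>g<4. of_nat (m g) * (complex_of_real (w g) * of_nat g / (t + of_nat g) ^ 3)) = 0"
                using eq[of "\<lambda>g. of_real (w g) * of_nat g"] \<open>K \<noteq> 0\<close> c1 by simp
              then show ?thesis by (simp add: mult.assoc)
            qed
          qed (use m2 m_nz in auto)
        qed
      qed
    qed
  qed auto
  then show ?thesis
    unfolding paired_cubics_quadric_ci_def by blast
qed

section \<open>Chern ratios of the vertices\<close>

definition ratio_x :: "nat \<Rightarrow> real" where
  "ratio_x m = (if m = 1 then 1 / 16 else if m = 2 then 1 / 10 else if m = 3 then 1 / 8
     else if m = 4 then 1 / 6 else if m = 5 then 1 / 3
     else 2 * (real m - 4)\<^sup>2 / ((real m)\<^sup>2 - 5 * real m + 12))"

definition ratio_y :: "nat \<Rightarrow> real" where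
  "ratio_y m = (if m = 1 then 43 / 8 else if m = 2 then 19 / 5 else if m = 3 then 13 / 4
     else if m = 4 then 8 / 3 else if m = 5 then 23 / 12
     else (real m ^ 3 - 3 * (real m)\<^sup>2 + 14 * real m - 24)
       / (3 * (real m - 4) * ((real m)\<^sup>2 - 5 * real m + 12)))"

definition has_ratios :: "complete_intersection \<Rightarrow> real \<Rightarrow> real \<Rightarrow> bool" where
  "has_ratios X x y \<longleftrightarrow> sci_threefold X \<and> canonical_ample X \<and>
     c1_c2 X < 0 \<and> c1_cubed X = c1_c2 X * x \<and> c3 X = c1_c2 X * y"

text \<open>All Chern numbers carry the factor \<open>hyperplane_degree X\<close>, so their ratios
  depend on the power sums only. The coefficient of the second class is positive because
  \<open>A^2 >= 5 * A\<close>.\<close>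

lemma has_ratiosI:
  assumes "sci_threefold X"
    and s: "excess_power_sum X 1 = A" "excess_power_sum X 2 = B" "excess_power_sum X 3 = D"
    and "A \<ge> 5" "A \<le> B"
    and x: "x = (A - 4)\<^sup>2 / ((A\<^sup>2 + B) / 2 - 3 * (A - 2))"
    and y: "y = ((A ^ 3 + 3 * A * B + 2 * D) / 6 - (A\<^sup>2 + B) + 3 * A - 4)
        / ((A - 4) * ((A\<^sup>2 + B) / 2 - 3 * (A - 2)))"
  shows "has_ratios X x y"
proof -
  define c2 h where "c2 = (A\<^sup>2 + B) / 2 - 3 * (A - 2)" and "h = hyperplane_degree X"
  have "5 * A \<le> A\<^sup>2" using \<open>A \<ge> 5\<close> by (simp add: power2_eq_square)
  then have "c2 > 0" using assms by (simp add: c2_def)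
  have "h > 0"
    using assms(1) unfolding h_def hyperplane_degree_def sci_threefold_def
    by (intro prod_pos) (auto simp: Suc_le_eq)
  have "real_of_int (canonical_twist X) = A - 4"
    unfolding canonical_twist_eq_neg_c1 chern_coeff_explicit s by simp
  then have "canonical_twist X > 0" using \<open>A \<ge> 5\<close> by linarith
  then have "canonical_ample X"
    using assms(1) by (subst canonical_ample_iff) (auto simp: sci_threefold_def)
  have c1: "c1_cubed X = (4 - A) ^ 3 * h" "c1_c2 X = (4 - A) * c2 * h"
    unfolding c1_cubed_def c1_c2_def chern_coeff_explicit s c2_def h_def by simp_all
  have c3: "c3 X = - ((A ^ 3 + 3 * A * B + 2 * D) / 6 - (A\<^sup>2 + B) + 3 * A - 4) * h"
    unfolding c3_def chern_coeff_explicit s h_def by (simp add: field_simps)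
  have "c1_c2 X < 0"
    unfolding c1 using \<open>A \<ge> 5\<close> \<open>c2 > 0\<close> \<open>h > 0\<close> by (simp add: mult_less_0_iff)
  moreover have "c1_cubed X = c1_c2 X * x"
    unfolding c1 x c2_def[symmetric] using \<open>c2 > 0\<close>
    by (simp add: power2_eq_square power3_eq_cube field_simps)
  moreover have "c3 X = c1_c2 X * y"
    unfolding c1 c3 y c2_def[symmetric] using \<open>c2 > 0\<close> \<open>A \<ge> 5\<close>
    by (simp add: field_simps)
  ultimately show ?thesis
    unfolding has_ratios_def using assms(1) \<open>canonical_ample X\<close> by blast
qed

lemma excess_power_sum_vandermonde:
  "excess_power_sum (vandermonde_ci n e) j = real n * (real e - 1) ^ j"
  by (simp add: excess_power_sum_def vandermonde_ci_def)

text \<open>The values of \<open>A, B, D\<close> are the power sums of the \<open>d_i\<close>. For a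
  single form the Vandermonde coefficients are all 1, as \<open>0 ^ 0 = 1\<close>, so the first
  example is the Fermat sextic.\<close>

lemma ratios_attained:
  assumes "m \<ge> 1"
  shows "\<exists>X. has_ratios X (ratio_x m) (ratio_y m)"
proof -
  consider "m = 1" | "m = 2" | "m = 3" | "m = 4" | "m = 5" | "m \<ge> 6" using assms by linarith
  then show ?thesis
  proof cases
    case 1
    show ?thesis
      by (intro exI[of _ "vandermonde_ci 1 6"] has_ratiosI[where A = 5 and B = 25 and D = 125, OF sci_threefold_vandermonde[of 1 6]])
         (simp_all add: 1 excess_power_sum_vandermonde ratio_x_def ratio_y_def power2_eq_square)
  next
    case 2
    have "excess_power_sum quartic_cubic_ci j = 3 ^ j + 2 ^ j" for j
      by (simp add: excess_power_sum_def quartic_cubic_ci_def eval_nat_numeral)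
    then show ?thesis
      by (intro exI[of _ quartic_cubic_ci] has_ratiosI[where A = 5 and B = 13 and D = 35, OF sci_threefold_quartic_cubic]) (simp_all add: 2 ratio_x_def ratio_y_def)
  next
    case 3
    obtain w where w: "sci_threefold (paired_cubics_quadric_ci w)" using sci_threefold_cubics_quadric by blast
    have "excess_power_sum (paired_cubics_quadric_ci w) j = 2 ^ j + 2 ^ j + 1" for j
      by (simp add: excess_power_sum_def paired_cubics_quadric_ci_def sum_lessThan_3)
    then show ?thesis
      by (intro exI[of _ "paired_cubics_quadric_ci w"] has_ratiosI[where A = 5 and B = 9 and D = 17, OF w]) (simp_all add: 3 ratio_x_def ratio_y_def)
  next
    case 4
    show ?thesis
      by (intro exI[of _ "vandermonde_ci 5 2"] has_ratiosI[where A = 5 and B = 5 and D = 5, OF sci_threefold_vandermonde[of 5 2]])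
         (simp_all add: 4 excess_power_sum_vandermonde ratio_x_def ratio_y_def power2_eq_square)
  next
    case 5
    show ?thesis
      by (intro exI[of _ "vandermonde_ci 3 3"] has_ratiosI[where A = 6 and B = 12 and D = 24, OF sci_threefold_vandermonde[of 3 3]])
         (simp_all add: 5 excess_power_sum_vandermonde ratio_x_def ratio_y_def power2_eq_square)
  next
    case 6
    have "excess_power_sum (vandermonde_ci m 2) j = real m" for j
      by (simp add: excess_power_sum_vandermonde)
    have "6 * real m \<le> (real m)\<^sup>2" using 6 by (simp add: power2_eq_square)
    then have nz: "(real m)\<^sup>2 - 5 * real m + 12 \<noteq> 0" "real m - 4 \<noteq> 0" using 6 by auto
    have c2: "((real m)\<^sup>2 + real m) / 2 - 3 * (real m - 2) = ((real m)\<^sup>2 - 5 * real m + 12) / 2"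
      by (simp add: field_simps)
    have c3: "(real m ^ 3 + 3 * real m * real m + 2 * real m) / 6 - ((real m)\<^sup>2 + real m) + 3 * real m - 4
       = (real m ^ 3 - 3 * (real m)\<^sup>2 + 14 * real m - 24) / 6"
      by (simp add: field_simps power2_eq_square)
    have "has_ratios (vandermonde_ci m 2) (ratio_x m) (ratio_y m)"
    proof (rule has_ratiosI)
      show "ratio_x m = (real m - 4)\<^sup>2 / (((real m)\<^sup>2 + real m) / 2 - 3 * (real m - 2))"
        using 6 unfolding c2 by (simp add: ratio_x_def)
      show "ratio_y m = ((real m ^ 3 + 3 * real m * real m + 2 * real m) / 6 - ((real m)\<^sup>2 + real m) + 3 * real m - 4)
         / ((real m - 4) * (((real m)\<^sup>2 + real m) / 2 - 3 * (real m - 2)))"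
        using 6 nz unfolding c2 c3 by (simp add: ratio_y_def frac_eq_eq) (simp add: algebra_simps)
    qed (use 6 in \<open>auto simp: excess_power_sum_vandermonde intro: sci_threefold_vandermonde\<close>)
    then show ?thesis by blast
  qed
qed


section \<open>Edges of cones\<close>

definition pointed :: "'a::real_vector set \<Rightarrow> bool" where
  "pointed C \<longleftrightarrow> (\<forall>x. x \<in> C \<longrightarrow> - x \<in> C \<longrightarrow> x = 0)"

lemma cone_hull_singleton: "cone hull {u} = {c *\<^sub>R u | c. c \<ge> 0}"
  by (auto simp: cone_hull_expl)

lemma pointed_multiple:
  assumes "cone C" "pointed C" "u \<in> C" "c *\<^sub>R u \<in> C"
  shows "c *\<^sub>R u \<in> cone hull {u}"
proof (cases "c \<ge> 0")
  case True
  then show ?thesis by (auto simp: cone_hull_singleton)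
next
  case False
  then have "- (c *\<^sub>R u) \<in> C"
    using mem_cone[OF assms(1,3), of "- c"] by simp
  then have "c *\<^sub>R u = 0"
    using assms(2,4) by (auto simp: pointed_def)
  then show ?thesis by (auto simp: cone_hull_singleton intro: exI[of _ 0])
qed

text \<open>Scaling the ends of a segment turns a convex combination on the ray into a sum
  \<open>a + b\<close> on the ray, and a further scaling into a sum equal to \<open>u\<close>.
  Pointedness settles the sum 0.\<close>

lemma edge_of_coneI:
  fixes C :: "'a::euclidean_space set"
  assumes C: "cone C" "pointed C" and u: "u \<in> C" "u \<noteq> 0"
    and ext: "\<And>a b. \<lbrakk>a \<in> C; b \<in> C; a + b = u\<rbrakk> \<Longrightarrow> \<exists>c. a = c *\<^sub>R u"
  shows "cone hull {u} edge_of C"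
proof -
  have ray: "a \<in> cone hull {u}" if ab: "a \<in> C" "b \<in> C" "a + b = c *\<^sub>R u" "c \<ge> 0" for a b c
  proof (cases "c = 0")
    case True
    then have "- a \<in> C" using ab by (metis add_eq_0_iff scale_zero_left)
    then have "a = 0" using C(2) ab(1) by (auto simp: pointed_def)
    then show ?thesis by (auto simp: cone_hull_singleton intro: exI[of _ 0])
  next
    case False
    then have "(1 / c) *\<^sub>R a + (1 / c) *\<^sub>R b = u"
      using ab(3) by (simp flip: scaleR_right_distrib)
    moreover have "(1 / c) *\<^sub>R a \<in> C" "(1 / c) *\<^sub>R b \<in> C"
      using ab by (auto intro: mem_cone[OF C(1)])
    ultimately obtain d where "(1 / c) *\<^sub>R a = d *\<^sub>R u" using ext by blast
    then have "c *\<^sub>R (1 / c) *\<^sub>R a = c *\<^sub>R d *\<^sub>R u" by simp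
    then have "a = (c * d) *\<^sub>R u" using False by simp
    then show ?thesis using pointed_multiple[OF C u(1), of "c * d"] ab(1) by simp
  qed
  have scale: "a \<in> cone hull {u}" if "s *\<^sub>R a \<in> cone hull {u}" "s > 0" for s a
    using mem_cone[OF cone_cone_hull that(1), of "1 / s"] that(2) by simp
  have sub: "cone hull {u} \<subseteq> C"
    using u(1) C(1) by (auto simp: cone_hull_singleton intro: mem_cone)
  have "a \<in> cone hull {u} \<and> b \<in> cone hull {u}"
    if "a \<in> C" "b \<in> C" and x: "x \<in> cone hull {u}" "x \<in> open_segment a b" for a b x
  proof -
    obtain t where t: "0 < t" "t < 1" "x = (1 - t) *\<^sub>R a + t *\<^sub>R b"
      using x(2) by (auto simp: in_segment)
    obtain c where c: "x = c *\<^sub>R u" "c \<ge> 0"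
      using x(1) by (auto simp: cone_hull_singleton)
    have in_C: "(1 - t) *\<^sub>R a \<in> C" "t *\<^sub>R b \<in> C"
      using that t by (auto intro: mem_cone[OF C(1)])
    have "(1 - t) *\<^sub>R a \<in> cone hull {u}"
      using ray[OF in_C, of c] t(3) c by simp
    moreover have "t *\<^sub>R b \<in> cone hull {u}"
      using ray[OF in_C(2) in_C(1), of c] t(3) c by (simp add: add.commute)
    ultimately show ?thesis using scale t by auto
  qed
  moreover have "convex (cone hull {u})"
    by (rule convex_cone_hull) simp
  ultimately have "cone hull {u} face_of C"
    unfolding face_of_def using sub by blast
  moreover have "aff_dim (cone hull {u}) = 1"
  proof -
    have "u \<in> cone hull {u}" by (simp add: hull_inc)
    moreover have "cone hull {u} \<subseteq> span {u}"
      by (auto simp: cone_hull_singleton span_singleton)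
    ultimately have "span (cone hull {u}) = span {u}"
      by (auto intro!: span_eq[THEN iffD2] simp: span_base)
    then have "dim (cone hull {u}) = dim {u}"
      by (metis dim_span)
    moreover have "dim {u} = 1" using u(2) by simp
    moreover have "0 \<in> cone hull {u}" using cone_hull_contains_0[of "{u}"] by simp
    ultimately show ?thesis by (simp add: aff_dim_zero hull_inc)
  qed
  ultimately show ?thesis by (simp add: edge_of_def)
qed

text \<open>A face of a cone is a cone, so an edge contains 0 and spans a line; pointedness leaves
  one half of it.\<close>

lemma edge_of_cone_eq_ray:
  fixes C :: "'a::euclidean_space set"
  assumes C: "cone C" "pointed C" and E: "E edge_of C" and u: "u \<in> E" "u \<noteq> 0"
  shows "E = cone hull {u}"
proof
  have face: "E face_of C" and dim: "aff_dim E = 1" using E by (auto simp: edge_of_def)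
  have "conic C" using C(1) by (simp add: cone_def conic_def)
  then have "cone E"
    using face_of_conic[OF _ face] by (simp add: cone_def conic_def)
  then show "cone hull {u} \<subseteq> E"
    using u(1) by (auto simp: cone_hull_singleton intro: mem_cone)
  have "0 \<in> E" using \<open>cone E\<close> u(1) cone_contains_0 by blast
  then have "dim E = 1" using dim by (simp add: aff_dim_zero hull_inc)
  then have "span {u} = span E"
    using u by (intro dim_eq_span) auto
  show "E \<subseteq> cone hull {u}"
  proof
    fix x assume "x \<in> E"
    then have "x \<in> span {u}" unfolding \<open>span {u} = span E\<close> by (rule span_base)
    then obtain c where "x = c *\<^sub>R u" by (auto simp: span_singleton)
    moreover have "E \<subseteq> C" using face by (rule face_of_imp_subset)
    ultimately show "x \<in> cone hull {u}"
      using pointed_multiple[OF C, of u c] \<open>x \<in> E\<close> u(1) by auto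
  qed
qed

text \<open>The midpoint of \<open>a\<close> and \<open>b\<close> lies in \<open>E\<close> by
  scaling. If \<open>a = b\<close>, the open segment is empty and the midpoint is \<open>a\<close>
  itself.\<close>

lemma face_of_cone_summand:
  assumes "cone C" "E face_of C" "a \<in> C" "b \<in> C" "a + b \<in> E"
  shows "a \<in> E"
proof -
  have "conic C" using assms(1) by (simp add: cone_def conic_def)
  then have "conic E" using assms(2) by (rule face_of_conic)
  then have half: "(1 / 2) *\<^sub>R (a + b) \<in> E"
    using assms(5) by (simp add: conic_def del: scaleR_add_right)
  show ?thesis
  proof (cases "a = b")
    case True
    then show ?thesis using half by (simp flip: scaleR_2)
  next
    case False
    then have "(1 / 2) *\<^sub>R (a + b) \<in> open_segment a b"
      by (auto simp: in_segment scaleR_right_distrib intro!: exI[of _ "1 / 2"])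
    then show ?thesis using face_ofD[OF assms(2) _ assms(3,4) half] by blast
  qed
qed


section \<open>The cone of Chern number inequalities\<close>

lemma line_through_ratios:
  assumes "m \<ge> 1"
  shows "line_slope m * ratio_x m + line_intercept m = ratio_y m"
    and "line_slope m * ratio_x (Suc m) + line_intercept m = ratio_y (Suc m)"
    and "ratio_x m < ratio_x (Suc m)"
proof -
  consider "m = 1" | "m = 2" | "m = 3" | "m = 4" | "m = 5" | "m \<ge> 6" using assms by linarith
  then have "line_slope m * ratio_x m + line_intercept m = ratio_y m \<and>
    line_slope m * ratio_x (Suc m) + line_intercept m = ratio_y (Suc m) \<and> ratio_x m < ratio_x (Suc m)"
  proof cases
    case 6
    define x where "x = real m"
    have "6 * x \<le> x\<^sup>2" "x \<ge> 6" using 6 by (simp_all add: x_def power2_eq_square)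
    then have pos: "x\<^sup>2 - 5 * x + 12 > 0" "x\<^sup>2 - 3 * x + 8 > 0" "3 * x\<^sup>2 - 5 * x - 20 > 0"
      "x - 4 > 0" "x - 3 > 0"
      by linarith+
    define a b c d e where "a = x\<^sup>2 - 5 * x + 12" and "b = x\<^sup>2 - 3 * x + 8"
      and "c = 3 * x\<^sup>2 - 5 * x - 20" and "d = x - 4" and "e = x - 3"
    have nz: "a \<noteq> 0" "b \<noteq> 0" "c \<noteq> 0" "d \<noteq> 0" "e \<noteq> 0"
      using pos by (simp_all add: a_def b_def c_def d_def e_def)
    define k l where "k = - 28 * x + x\<^sup>2 + 4 * x ^ 3 - x ^ 4"
      and "l = - 120 + 254 * x + 3 * x\<^sup>2 - 50 * x ^ 3 + 9 * x ^ 4"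
    define p q where "p = x ^ 3 - 3 * x\<^sup>2 + 14 * x - 24" and "q = x ^ 3 + 11 * x - 12"
    have X: "ratio_x m = 2 * d\<^sup>2 / a" "ratio_x (Suc m) = 2 * e\<^sup>2 / b"
      and Y: "ratio_y m = p / (3 * d * a)" "ratio_y (Suc m) = q / (3 * e * b)"
      and KL: "line_slope m = k / (d * e * c)" "line_intercept m = l / (3 * d * e * c)"
      using 6 by (simp_all add: ratio_x_def ratio_y_def line_slope_def line_intercept_def x_def
          a_def b_def c_def d_def e_def k_def l_def p_def q_def power2_eq_square power3_eq_cube algebra_simps)
    have "6 * k * d ^ 2 + l * a = p * e * c" "6 * k * e ^ 2 + l * b = q * d * c" "e\<^sup>2 * a - d\<^sup>2 * b = c"
      unfolding a_def b_def c_def d_def e_def k_def l_def p_def q_def by algebra+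
    note eqs = this
    have "k / (d * e * c) * (2 * d\<^sup>2 / a) + l / (3 * d * e * c) = (6 * k * d ^ 2 + l * a) / (3 * d * e * c * a)"
      using nz by (simp add: field_simps)
    also have "\<dots> = p / (3 * d * a)"
      unfolding eqs using nz by (simp add: field_simps)
    finally have 1: "k / (d * e * c) * (2 * d\<^sup>2 / a) + l / (3 * d * e * c) = p / (3 * d * a)" .
    have "k / (d * e * c) * (2 * e\<^sup>2 / b) + l / (3 * d * e * c) = (6 * k * e ^ 2 + l * b) / (3 * d * e * c * b)"
      using nz by (simp add: field_simps)
    also have "\<dots> = q / (3 * e * b)"
      unfolding eqs using nz by (simp add: field_simps)
    finally have 2: "k / (d * e * c) * (2 * e\<^sup>2 / b) + l / (3 * d * e * c) = q / (3 * e * b)" .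
    have "2 * e\<^sup>2 / b - 2 * d\<^sup>2 / a = 2 * (e\<^sup>2 * a - d\<^sup>2 * b) / (a * b)"
      using nz by (simp add: field_simps)
    also have "\<dots> > 0"
      unfolding eqs using pos by (simp add: a_def b_def c_def)
    finally have "2 * d\<^sup>2 / a < 2 * e\<^sup>2 / b" by simp
    with 1 2 show ?thesis unfolding X Y KL by simp
  qed (auto simp: line_slope_def line_intercept_def ratio_x_def ratio_y_def)
  then show "line_slope m * ratio_x m + line_intercept m = ratio_y m"
    "line_slope m * ratio_x (Suc m) + line_intercept m = ratio_y (Suc m)" "ratio_x m < ratio_x (Suc m)"
    by blast+
qed

lemma eventually_ge_6:
  assumes "\<And>m. m \<ge> (6::nat) \<Longrightarrow> P m"
  shows "\<forall>\<^sub>F m in sequentially. P m"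
  using assms by (rule eventually_sequentiallyI)

lemma ratio_limits:
  shows "ratio_x \<longlonglongrightarrow> 2" "ratio_y \<longlonglongrightarrow> 1 / 3"
    and "(\<lambda>m. real m * (ratio_x m - 2)) \<longlonglongrightarrow> - 6" "(\<lambda>m. real m * (ratio_y m - 1 / 3)) \<longlonglongrightarrow> 2"
    and "line_slope \<longlonglongrightarrow> limit_slope"
proof -
  have "(\<lambda>m. 2 * (real m - 4)\<^sup>2 / ((real m)\<^sup>2 - 5 * real m + 12)) \<longlonglongrightarrow> 2"
    by real_asymp
  then show "ratio_x \<longlonglongrightarrow> 2"
    by (rule Lim_transform_eventually) (auto intro!: eventually_ge_6 simp: ratio_x_def)
  have "(\<lambda>m. (real m ^ 3 - 3 * (real m)\<^sup>2 + 14 * real m - 24)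
       / (3 * (real m - 4) * ((real m)\<^sup>2 - 5 * real m + 12))) \<longlonglongrightarrow> 1 / 3"
    by real_asymp
  then show "ratio_y \<longlonglongrightarrow> 1 / 3"
    by (rule Lim_transform_eventually) (auto intro!: eventually_ge_6 simp: ratio_y_def)
  have "(\<lambda>m. real m * (2 * (real m - 4)\<^sup>2 / ((real m)\<^sup>2 - 5 * real m + 12) - 2)) \<longlonglongrightarrow> - 6"
    by real_asymp
  then show "(\<lambda>m. real m * (ratio_x m - 2)) \<longlonglongrightarrow> - 6"
    by (rule Lim_transform_eventually) (auto intro!: eventually_ge_6 simp: ratio_x_def)
  have "(\<lambda>m. real m * ((real m ^ 3 - 3 * (real m)\<^sup>2 + 14 * real m - 24)
       / (3 * (real m - 4) * ((real m)\<^sup>2 - 5 * real m + 12)) - 1 / 3)) \<longlonglongrightarrow> 2"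
    by real_asymp
  then show "(\<lambda>m. real m * (ratio_y m - 1 / 3)) \<longlonglongrightarrow> 2"
    by (rule Lim_transform_eventually) (auto intro!: eventually_ge_6 simp: ratio_y_def)
  have "(\<lambda>m. (- 28 * real m + real m ^ 2 + 4 * real m ^ 3 - real m ^ 4) /
           ((real m - 4) * (real m - 3) * (3 * real m ^ 2 - 5 * real m - 20))) \<longlonglongrightarrow> - 1 / 3"
    by real_asymp
  then show "line_slope \<longlonglongrightarrow> limit_slope"
    unfolding limit_slope_def
    by (rule Lim_transform_eventually) (auto intro!: eventually_ge_6 simp: line_slope_def)
qed

lemma chern_number_gap:
  fixes X :: complete_intersection
  defines "s \<equiv> excess_power_sum X"
  shows "k * c1_cubed X + b * c1_c2 X - c3 X = gap k b (s 1) (s 2) (s 3) * hyperplane_degree X"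
proof -
  have "k * c1_cubed X + b * c1_c2 X - c3 X = (k * (4 - s 1) ^ 3
      + b * ((4 - s 1) * (((s 1)\<^sup>2 + s 2) / 2 - 3 * (s 1 - 2)))
      - (- ((s 1)^3 + 3 * s 1 * s 2 + 2 * s 3) / 6 + ((s 1)^2 + s 2) - 3 * s 1 + 4)) * hyperplane_degree X"
    unfolding c1_cubed_def c1_c2_def c3_def chern_coeff_explicit s_def by (simp only: algebra_simps)
  also have "k * (4 - s 1) ^ 3 + b * ((4 - s 1) * (((s 1)\<^sup>2 + s 2) / 2 - 3 * (s 1 - 2)))
      - (- ((s 1)^3 + 3 * s 1 * s 2 + 2 * s 3) / 6 + ((s 1)^2 + s 2) - 3 * s 1 + 4)
      = gap k b (s 1) (s 2) (s 3)"
    unfolding gap_def by (simp add: field_simps power2_eq_square power3_eq_cube)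
  finally show ?thesis .
qed

lemma edge_vectors_subset: "edge_vectors \<subseteq> chern_cone"
proof -
  have main: "line_slope 0 * c1_cubed X + line_intercept 0 * c1_c2 X - c3 X \<le> 0 \<and>
      (\<forall>m\<ge>1. 0 \<le> line_slope m * c1_cubed X + line_intercept m * c1_c2 X - c3 X) \<and>
      0 \<le> limit_slope * c1_cubed X + limit_intercept * c1_c2 X - c3 X"
    if X: "sci_threefold X" "canonical_ample X" for X
  proof -
    define n d where "n = ci_codim X" and "d i = ci_deg X i - 1" for i
    have deg: "ci_deg X i \<ge> 1" if "i < n" for i
      using X(1) that by (auto simp: sci_threefold_def n_def)
    have s: "excess_power_sum X j = (\<Sum>i<n. real (d i) ^ j)" for j
      using deg by (auto simp: excess_power_sum_def n_def d_def of_nat_diff intro!: sum.cong)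
    have "canonical_twist X > 0"
      using X by (subst canonical_ample_iff[symmetric]) (auto simp: sci_threefold_def)
    moreover have "real_of_int (canonical_twist X) = real (\<Sum>i<n. d i) - 4"
      unfolding canonical_twist_eq_neg_c1 chern_coeff_explicit s by simp
    \<comment> \<open>The twist is a positive integer, hence at least 1.\<close>
    ultimately have "5 \<le> (\<Sum>i<n. d i)" by linarith
    note ineqs = gap_edge_lines[OF this, folded s]
    have "hyperplane_degree X \<ge> 0"
      unfolding hyperplane_degree_def by (intro prod_nonneg) auto
    then show ?thesis
      unfolding chern_number_gap using ineqs
      by (auto simp: mult_le_0_iff)
  qed
  show ?thesis
    using main unfolding edge_vectors_def chern_cone_def by (auto simp: algebra_simps)
qed

lemma chern_cone_ratio_ineq:
  assumes "v \<in> chern_cone" "m \<ge> 1"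
  shows "v $ 1 * ratio_x m + v $ 2 + v $ 3 * ratio_y m \<le> 0"
proof -
  obtain X where X: "has_ratios X (ratio_x m) (ratio_y m)"
    using ratios_attained[OF assms(2)] by blast
  then have "0 \<le> c1_c2 X * (v $ 1 * ratio_x m + v $ 2 + v $ 3 * ratio_y m)"
    using assms(1) by (auto simp: chern_cone_def has_ratios_def algebra_simps)
  then show ?thesis
    using X by (simp add: has_ratios_def zero_le_mult_iff)
qed

text \<open>If the affine function vanishes at the limit point, its values at the vertices,
  multiplied by \<open>m\<close>, are still nonpositive and now converge, to
  \<open>- 6 * v $ 1 + 2 * v $ 3\<close>.\<close>

lemma chern_cone_limit_ineq:
  assumes "v \<in> chern_cone"
  shows "v $ 1 * 2 + v $ 2 + v $ 3 * (1 / 3) \<le> 0"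
    and "v $ 1 * 2 + v $ 2 + v $ 3 * (1 / 3) = 0 \<Longrightarrow> v $ 3 \<le> 3 * v $ 1"
proof -
  have "(\<lambda>m. v $ 1 * ratio_x m + v $ 2 + v $ 3 * ratio_y m) \<longlonglongrightarrow> v $ 1 * 2 + v $ 2 + v $ 3 * (1 / 3)"
    by (intro tendsto_intros ratio_limits)
  then show "v $ 1 * 2 + v $ 2 + v $ 3 * (1 / 3) \<le> 0"
    by (rule LIMSEQ_le_const2) (use chern_cone_ratio_ineq[OF assms] in blast)
  assume eq: "v $ 1 * 2 + v $ 2 + v $ 3 * (1 / 3) = 0"
  have "v $ 1 * (real m * (ratio_x m - 2)) + v $ 3 * (real m * (ratio_y m - 1 / 3)) \<le> 0" if "m \<ge> 1" for m
  proof -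
    have "v $ 1 * (real m * (ratio_x m - 2)) + v $ 3 * (real m * (ratio_y m - 1 / 3))
        = real m * (v $ 1 * ratio_x m + v $ 2 + v $ 3 * ratio_y m - (v $ 1 * 2 + v $ 2 + v $ 3 * (1 / 3)))"
      by (simp add: algebra_simps)
    then show ?thesis
      using chern_cone_ratio_ineq[OF assms that] eq by (simp add: mult_nonneg_nonpos)
  qed
  moreover have "(\<lambda>m. v $ 1 * (real m * (ratio_x m - 2)) + v $ 3 * (real m * (ratio_y m - 1 / 3)))
      \<longlonglongrightarrow> v $ 1 * (- 6) + v $ 3 * 2"
    by (intro tendsto_intros ratio_limits)
  ultimately have "v $ 1 * (- 6) + v $ 3 * 2 \<le> 0"
    by (intro LIMSEQ_le_const2) auto
  then show "v $ 3 \<le> 3 * v $ 1" by simp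
qed

lemma cone_chern_cone: "cone chern_cone"
proof -
  have "c * v $ 1 * c1_cubed X + c * v $ 2 * c1_c2 X + c * v $ 3 * c3 X
     = c * (v $ 1 * c1_cubed X + v $ 2 * c1_c2 X + v $ 3 * c3 X)" for c X and v :: "real ^ 3"
    by (simp add: algebra_simps)
  then show ?thesis
    by (auto simp: cone_def chern_cone_def)
qed

lemma chern_cone_add:
  assumes "u \<in> chern_cone" "v \<in> chern_cone"
  shows "u + v \<in> chern_cone"
  unfolding chern_cone_def
proof (intro CollectI allI impI)
  fix X assume X: "sci_threefold X \<and> canonical_ample X"
  have "0 \<le> u $ 1 * c1_cubed X + u $ 2 * c1_c2 X + u $ 3 * c3 X"
    "0 \<le> v $ 1 * c1_cubed X + v $ 2 * c1_c2 X + v $ 3 * c3 X"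
    using assms X by (auto simp: chern_cone_def)
  then show "0 \<le> (u + v) $ 1 * c1_cubed X + (u + v) $ 2 * c1_c2 X + (u + v) $ 3 * c3 X"
    by (simp add: distrib_right)
qed

lemma chern_cone_scale: "v \<in> chern_cone \<Longrightarrow> c \<ge> 0 \<Longrightarrow> c *\<^sub>R v \<in> chern_cone"
  using cone_chern_cone by (auto intro: mem_cone)

lemma convex_chern_cone: "convex chern_cone"
  unfolding convex_def by (auto intro: chern_cone_add chern_cone_scale)

text \<open>The points \<open>p_1\<close>, \<open>p_2\<close>, \<open>p_3\<close> are not collinear,
  so an affine function vanishing at all three is zero.\<close>

lemma pointed_chern_cone: "pointed chern_cone"
  unfolding pointed_def
proof (intro allI impI)
  fix v assume v: "v \<in> chern_cone" "- v \<in> chern_cone"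
  have eq: "v $ 1 * ratio_x m + v $ 2 + v $ 3 * ratio_y m = 0" if "m \<ge> 1" for m
    using chern_cone_ratio_ineq[OF v(1) that] chern_cone_ratio_ineq[OF v(2) that] by simp
  from eq[of 1] eq[of 2] eq[of 3] have "v $ 1 = 0" "v $ 2 = 0" "v $ 3 = 0"
    by (simp_all add: ratio_x_def ratio_y_def)
  then show "v = 0" by (simp add: vec_eq_iff forall_3)
qed

lemma edge_of_chern_cone:
  assumes "u \<in> edge_vectors"
  shows "cone hull {u} edge_of chern_cone" "u \<noteq> 0"
proof -
  have u: "u \<in> chern_cone" using assms edge_vectors_subset by blast
  show "u \<noteq> 0" using assms unfolding edge_vectors_def by (auto simp: vec_eq_iff forall_3)
  have ext: "\<exists>c. a = c *\<^sub>R u" if a: "a \<in> chern_cone" and b: "b \<in> chern_cone" and sum: "a + b = u" for a b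
  proof -
    have comps: "a $ i + b $ i = u $ i" for i using sum by auto
    from assms consider
      "u = vector [- line_slope 0, - line_intercept 0, 1]"
      | m where "m \<ge> 1" "u = vector [line_slope m, line_intercept m, - 1]"
      | "u = vector [limit_slope, limit_intercept, - 1]"
      unfolding edge_vectors_def by blast
    then show ?thesis
    proof cases
      case 1
      have "a $ 1 * (1 / 16) + a $ 2 + a $ 3 * (43 / 8) = 0" "a $ 1 * 2 + a $ 2 + a $ 3 * (1 / 3) = 0"
        using chern_cone_ratio_ineq[OF a, of 1] chern_cone_ratio_ineq[OF b, of 1]
          chern_cone_limit_ineq(1)[OF a] chern_cone_limit_ineq(1)[OF b] comps[of 1] comps[of 2] comps[of 3]
        by (simp_all add: 1 ratio_x_def ratio_y_def line_slope_def line_intercept_def)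
      then have "a = (a $ 3) *\<^sub>R u"
        by (simp add: 1 vec_eq_iff forall_3 line_slope_def line_intercept_def)
      then show ?thesis by blast
    next
      case (2 m)
      define k l x y x' y' where "k = line_slope m" and "l = line_intercept m"
        and "x = ratio_x m" and "y = ratio_y m" and "x' = ratio_x (Suc m)" and "y' = ratio_y (Suc m)"
      have line: "y = k * x + l" "y' = k * x' + l" "x < x'"
        using line_through_ratios[OF 2(1)] by (simp_all add: k_def l_def x_def y_def x'_def y'_def)
      have u123: "u $ 1 = k" "u $ 2 = l" "u $ 3 = - 1" by (simp_all add: 2 k_def l_def)
      \<comment> \<open>The function of \<open>u\<close> is 0 at \<open>(p, q)\<close>, and it is
        the sum of two values that are both nonpositive.\<close>
      have zero: "a $ 1 * p + a $ 2 + a $ 3 * q = 0"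
        if "q = k * p + l" "a $ 1 * p + a $ 2 + a $ 3 * q \<le> 0" "b $ 1 * p + b $ 2 + b $ 3 * q \<le> 0" for p q
      proof -
        have "(a $ 1 + b $ 1) * p + (a $ 2 + b $ 2) + (a $ 3 + b $ 3) * q = 0"
          unfolding comps u123 that(1) by simp
        then show ?thesis using that(2,3) by (simp add: algebra_simps)
      qed
      have zeros: "a $ 1 * x + a $ 2 + a $ 3 * y = 0" "a $ 1 * x' + a $ 2 + a $ 3 * y' = 0"
        using zero line(1,2) chern_cone_ratio_ineq[OF a, of m] chern_cone_ratio_ineq[OF b, of m]
          chern_cone_ratio_ineq[OF a, of "Suc m"] chern_cone_ratio_ineq[OF b, of "Suc m"] 2(1)
        by (auto simp: x_def y_def x'_def y'_def)
      then have "(a $ 1 + a $ 3 * k) * (x' - x) = 0"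
        unfolding line(1,2) by (simp add: algebra_simps)
      then have a1: "a $ 1 = - a $ 3 * k" using line(3) by (simp add: add_eq_0_iff)
      then have a2: "a $ 2 = - a $ 3 * l"
        using zeros(1) unfolding line(1) by (simp add: algebra_simps)
      have "a = (- a $ 3) *\<^sub>R u"
        using a1 a2 by (simp add: vec_eq_iff forall_3 u123)
      then show ?thesis by blast
    next
      case 3
      have eqs: "a $ 1 * 2 + a $ 2 + a $ 3 * (1 / 3) = 0" "b $ 1 * 2 + b $ 2 + b $ 3 * (1 / 3) = 0"
        using chern_cone_limit_ineq(1)[OF a] chern_cone_limit_ineq(1)[OF b] comps[of 1] comps[of 2] comps[of 3]
        by (simp_all add: 3 limit_slope_def limit_intercept_def)
      \<comment> \<open>The limit vector satisfies \<open>u $ 3 = 3 * u $ 1\<close>, which forces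
        equality in the first-order conditions of both summands.\<close>
      have "a $ 3 = 3 * a $ 1"
        using chern_cone_limit_ineq(2)[OF a eqs(1)] chern_cone_limit_ineq(2)[OF b eqs(2)] comps[of 1] comps[of 3]
        by (simp add: 3 limit_slope_def)
      then have "a = (- a $ 3) *\<^sub>R u"
        using eqs(1) by (simp add: 3 vec_eq_iff forall_3 limit_slope_def limit_intercept_def)
      then show ?thesis by blast
    qed
  qed
  show "cone hull {u} edge_of chern_cone"
    using cone_chern_cone pointed_chern_cone u \<open>u \<noteq> 0\<close> ext by (rule edge_of_coneI)
qed

text \<open>Splitting off one edge vector replaces a full decomposition: a face containing
  \<open>v\<close> contains the summand \<open>a *\<^sub>R u\<close>, so an edge through
  \<open>v\<close> is the ray of \<open>u\<close>.\<close>

definition has_edge_component :: "real ^ 3 \<Rightarrow> bool" where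
  "has_edge_component v \<longleftrightarrow> (\<exists>u\<in>edge_vectors. \<exists>a>0. v - a *\<^sub>R u \<in> chern_cone)"

lemma has_edge_componentI:
  "\<lbrakk>u \<in> edge_vectors; a > 0; w \<in> chern_cone; v = a *\<^sub>R u + w\<rbrakk> \<Longrightarrow> has_edge_component v"
  unfolding has_edge_component_def by (auto intro!: bexI[of _ u] exI[of _ a])

lemma has_edge_component_add:
  assumes "has_edge_component v" "w \<in> chern_cone"
  shows "has_edge_component (v + w)"
proof -
  obtain u a where u: "u \<in> edge_vectors" "a > 0" "v - a *\<^sub>R u \<in> chern_cone"
    using assms(1) unfolding has_edge_component_def by blast
  show ?thesis
    by (rule has_edge_componentI[OF u(1,2) chern_cone_add[OF u(3) assms(2)]]) simp
qed

lemma has_edge_component_scale: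
  assumes "has_edge_component v" "c > 0"
  shows "has_edge_component (c *\<^sub>R v)"
proof -
  obtain u a where u: "u \<in> edge_vectors" "a > 0" "v - a *\<^sub>R u \<in> chern_cone"
    using assms(1) unfolding has_edge_component_def by blast
  show ?thesis
    by (rule has_edge_componentI[OF u(1) _ chern_cone_scale[OF u(3), of c], of "c * a"])
       (use u(2) assms(2) in \<open>simp_all add: algebra_simps\<close>)
qed

lemma edge_vectors_intros:
  "vector [- line_slope 0, - line_intercept 0, 1] \<in> edge_vectors"
  "m \<ge> 1 \<Longrightarrow> vector [line_slope m, line_intercept m, - 1] \<in> edge_vectors"
  "vector [limit_slope, limit_intercept, - 1] \<in> edge_vectors"
  unfolding edge_vectors_def by blast+

lemma horizontal_members:
  shows "vector [1, - 2, 0] \<in> chern_cone" "has_edge_component (vector [1, - 2, 0])"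
    and "vector [- 16, 1, 0] \<in> chern_cone" "has_edge_component (vector [- 16, 1, 0])"
    and "vector [0, - 1, 0] \<in> chern_cone" "has_edge_component (vector [0, - 1, 0])"
proof -
  let ?u0 = "vector [- line_slope 0, - line_intercept 0, 1] :: real ^ 3"
  let ?u1 = "vector [line_slope 1, line_intercept 1, - 1] :: real ^ 3"
  let ?v = "vector [limit_slope, limit_intercept, - 1] :: real ^ 3"
  have mem: "?u0 \<in> chern_cone" "?u1 \<in> chern_cone" "?v \<in> chern_cone"
    using edge_vectors_intros edge_vectors_subset by auto
  have right: "vector [1, - 2, 0] = (93 / 211) *\<^sub>R ?u0 + (93 / 211) *\<^sub>R ?v"
    by (simp add: vec_eq_iff forall_3 line_slope_def line_intercept_def limit_slope_def limit_intercept_def)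
  show r: "vector [1, - 2, 0] \<in> chern_cone"
    unfolding right by (intro chern_cone_add chern_cone_scale mem) auto
  show r': "has_edge_component (vector [1, - 2, 0])"
    by (rule has_edge_componentI[OF edge_vectors_intros(1) _ _ right]) (auto intro: chern_cone_scale mem)
  have left: "vector [- 16, 1, 0] = (93 / 229) *\<^sub>R ?u0 + (93 / 229) *\<^sub>R ?u1"
    by (simp add: vec_eq_iff forall_3 line_slope_def line_intercept_def)
  show l: "vector [- 16, 1, 0] \<in> chern_cone"
    unfolding left by (intro chern_cone_add chern_cone_scale mem) auto
  show "has_edge_component (vector [- 16, 1, 0])"
    by (rule has_edge_componentI[OF edge_vectors_intros(1) _ chern_cone_scale[OF mem(2)] left]) simp_all
  have down: "vector [0, - 1, 0]
      = (16 / 31) *\<^sub>R (vector [1, - 2, 0] :: real ^ 3) + (1 / 31) *\<^sub>R vector [- 16, 1, 0]"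
    by (simp add: vec_eq_iff forall_3)
  show "vector [0, - 1, 0] \<in> chern_cone"
    unfolding down by (intro chern_cone_add chern_cone_scale r l) auto
  show "has_edge_component (vector [0, - 1, 0])"
    unfolding down by (intro has_edge_component_add has_edge_component_scale chern_cone_scale r' l) auto
qed

text \<open>On \<open>1/16 <= x <= 2\<close> the sign of \<open>p\<close> tells at which endpoint
  \<open>p * x + q\<close> is largest; the slack there is the multiple of
  \<open>(0, -1, 0)\<close>.\<close>

lemma horizontal_decomposition:
  fixes p q :: real
  shows "0 \<le> p \<Longrightarrow> 2 * p + q \<le> 0 \<Longrightarrow> vector [p, q, 0] \<in> chern_cone"
    and "p \<le> 0 \<Longrightarrow> p / 16 + q \<le> 0 \<Longrightarrow> vector [p, q, 0] \<in> chern_cone"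
    and "0 \<le> p \<Longrightarrow> 2 * p + q \<le> 0 \<Longrightarrow> p \<noteq> 0 \<or> q \<noteq> 0 \<Longrightarrow> has_edge_component (vector [p, q, 0])"
    and "p \<le> 0 \<Longrightarrow> p / 16 + q \<le> 0 \<Longrightarrow> p \<noteq> 0 \<or> q \<noteq> 0 \<Longrightarrow> has_edge_component (vector [p, q, 0])"
proof -
  have r: "vector [p, q, 0] = p *\<^sub>R (vector [1, - 2, 0] :: real ^ 3) + (- 2 * p - q) *\<^sub>R vector [0, - 1, 0]"
    by (simp add: vec_eq_iff forall_3)
  have l: "vector [p, q, 0] = (- p / 16) *\<^sub>R (vector [- 16, 1, 0] :: real ^ 3) + (- p / 16 - q) *\<^sub>R vector [0, - 1, 0]"
    by (simp add: vec_eq_iff forall_3)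
  note mem = horizontal_members
  show "vector [p, q, 0] \<in> chern_cone" if "0 \<le> p" "2 * p + q \<le> 0"
    unfolding r using that by (intro chern_cone_add chern_cone_scale mem) auto
  show "vector [p, q, 0] \<in> chern_cone" if "p \<le> 0" "p / 16 + q \<le> 0"
    unfolding l using that by (intro chern_cone_add chern_cone_scale mem) auto
  show "has_edge_component (vector [p, q, 0])" if "0 \<le> p" "2 * p + q \<le> 0" "p \<noteq> 0 \<or> q \<noteq> 0"
  proof (cases "p = 0")
    case True
    then show ?thesis unfolding r using that has_edge_component_scale[OF mem(6), of "- q"] by simp
  next
    case False
    then show ?thesis
      unfolding r using that by (intro has_edge_component_add has_edge_component_scale chern_cone_scale mem) auto
  qed
  show "has_edge_component (vector [p, q, 0])" if "p \<le> 0" "p / 16 + q \<le> 0" "p \<noteq> 0 \<or> q \<noteq> 0"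
  proof (cases "p = 0")
    case True
    then show ?thesis unfolding l using that has_edge_component_scale[OF mem(6), of "- q"] by simp
  next
    case False
    then show ?thesis
      unfolding l using that by (intro has_edge_component_add has_edge_component_scale chern_cone_scale mem) auto
  qed
qed

text \<open>Discrete intermediate value argument: the first slope is at most \<open>k\<close>, and
  the slopes eventually exceed \<open>k\<close> because their limit does.\<close>

lemma slope_bracket:
  assumes "line_slope 1 \<le> k" "k < limit_slope"
  obtains m where "m \<ge> 1" "line_slope m \<le> k" "k < line_slope (Suc m)"
proof -
  have "\<forall>\<^sub>F m in sequentially. k < line_slope m"
    using ratio_limits(5) assms(2) by (rule order_tendstoD)
  then obtain N where N: "\<And>m. m \<ge> N \<Longrightarrow> k < line_slope m"
    by (auto simp: eventually_sequentially)
  have "\<exists>m\<ge>1. line_slope m \<le> k \<and> k < line_slope (Suc m)"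
  proof (rule ccontr)
    assume "\<not> ?thesis"
    then have step: "line_slope (Suc m) \<le> k" if "m \<ge> 1" "line_slope m \<le> k" for m
      using that by force
    have "line_slope (Suc m) \<le> k" for m
      by (induction m) (use assms(1) step in auto)
    then show False using N[of "Suc N"] by (meson le_SucI le_refl not_less)
  qed
  then show thesis using that by blast
qed

lemma chern_cone_has_edge_component:
  assumes v: "v \<in> chern_cone" "v \<noteq> 0"
  shows "has_edge_component v"
proof -
  define p q r where "p = v $ 1" and "q = v $ 2" and "r = v $ 3"
  have v_eq: "v = vector [p, q, r]" by (simp add: vec_eq_iff forall_3 p_def q_def r_def)
  have ratio: "p * ratio_x m + q + r * ratio_y m \<le> 0" if "m \<ge> 1" for m
    using chern_cone_ratio_ineq[OF v(1) that] by (simp add: p_def q_def r_def)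
  have first: "p / 16 + q + r * (43 / 8) \<le> 0"
    using ratio[of 1] by (simp add: ratio_x_def ratio_y_def)
  have last: "2 * p + q + r / 3 \<le> 0"
    using chern_cone_limit_ineq(1)[OF v(1)] by (simp add: p_def q_def r_def)
  consider "r = 0" | "r > 0" | "r < 0" by linarith
  then show ?thesis
  proof cases
    case 1
    then have "p \<noteq> 0 \<or> q \<noteq> 0" using v(2) unfolding v_eq by (auto simp: vec_eq_iff forall_3)
    then show ?thesis
      using horizontal_decomposition(3,4)[of p q] first last 1 unfolding v_eq
      by (cases "p \<ge> 0") auto
  next
    case 2
    \<comment> \<open>The upper line passes through \<open>p_1\<close> and the limit point, so the
      horizontal remainder has the same values there as \<open>v\<close>, and \<open>first\<close>
      and \<open>last\<close> apply to it.\<close>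
    let ?u = "vector [- line_slope 0, - line_intercept 0, 1] :: real ^ 3"
    have "v = r *\<^sub>R ?u + vector [p + r * line_slope 0, q + r * line_intercept 0, 0]"
      unfolding v_eq by (simp add: vec_eq_iff forall_3)
    moreover have "vector [p + r * line_slope 0, q + r * line_intercept 0, 0] \<in> chern_cone"
    proof (cases "p + r * line_slope 0 \<ge> 0")
      case True
      then show ?thesis
        by (rule horizontal_decomposition(1))
           (use last in \<open>simp add: line_slope_def line_intercept_def field_simps\<close>)
    next
      case False
      then have "p + r * line_slope 0 \<le> 0" by simp
      then show ?thesis
        by (rule horizontal_decomposition(2))
           (use first in \<open>simp add: line_slope_def line_intercept_def field_simps\<close>)
    qed
    ultimately show ?thesis
      using 2 edge_vectors_intros(1) by (intro has_edge_componentI)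
  next
    case 3
    define s k b where "s = - r" and "k = p / s" and "b = q / s"
    have "s > 0" using 3 by (simp add: s_def)
    then have pq: "p = s * k" "q = s * b" "r = - s"
      by (simp_all add: k_def b_def s_def)
    have v_s: "v = vector [s * k, s * b, - s]"
      unfolding v_eq pq ..
    have below: "k * ratio_x m + b \<le> ratio_y m" if "m \<ge> 1" for m
    proof -
      have "s * (k * ratio_x m + b - ratio_y m) \<le> 0"
        using ratio[OF that] unfolding pq by (simp add: algebra_simps)
      then show ?thesis using \<open>s > 0\<close> by (simp add: mult_le_0_iff)
    qed
    have last': "2 * k + b \<le> 1 / 3"
    proof -
      have "s * (2 * k + b - 1 / 3) \<le> 0"
        using last unfolding pq by (simp add: algebra_simps)
      then show ?thesis using \<open>s > 0\<close> by (simp add: mult_le_0_iff)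
    qed
    have horizontal: "v = s *\<^sub>R vector [k', b', - 1] + s *\<^sub>R vector [k - k', b - b', 0]" for k' b'
      unfolding v_s by (simp add: vec_eq_iff forall_3 algebra_simps)
    \<comment> \<open>The slope decides which point the line \<open>y = k * x + b\<close> meets
      first when moved upwards: the limit point, \<open>p_1\<close>, or the common vertex of lines
      \<open>m\<close> and \<open>m + 1\<close>.\<close>
    consider "limit_slope \<le> k" | "k < line_slope 1" | "line_slope 1 \<le> k" "k < limit_slope" by linarith
    then show ?thesis
    proof cases
      case 1
      have *: "vector [k - limit_slope, b - limit_intercept, 0] \<in> chern_cone"
        using 1 last' by (intro horizontal_decomposition(1)) (auto simp: limit_slope_def limit_intercept_def)
      show ?thesis
        by (rule has_edge_componentI[OF edge_vectors_intros(3) \<open>s > 0\<close> chern_cone_scale[OF *] horizontal])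
           (use \<open>s > 0\<close> in simp)
    next
      case 2
      have *: "vector [k - line_slope 1, b - line_intercept 1, 0] \<in> chern_cone"
        using 2 below[of 1]
        by (intro horizontal_decomposition(2)) (auto simp: line_slope_def line_intercept_def ratio_x_def ratio_y_def field_simps)
      show ?thesis
        by (rule has_edge_componentI[OF edge_vectors_intros(2) \<open>s > 0\<close> chern_cone_scale[OF *] horizontal])
           (use \<open>s > 0\<close> in simp_all)
    next
      case 3
      then obtain m where m: "m \<ge> 1" "line_slope m \<le> k" "k < line_slope (Suc m)"
        by (rule slope_bracket)
      define k0 k1 b0 b1 where "k0 = line_slope m" and "k1 = line_slope (Suc m)"
        and "b0 = line_intercept m" and "b1 = line_intercept (Suc m)"
      \<comment> \<open>Lines \<open>m\<close> and \<open>m + 1\<close> are mixed about their common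
        vertex so as to have slope \<open>k\<close>; \<open>t\<close> is the amount by which the
        given line stays below that vertex. As \<open>\<theta> < 1\<close>, line \<open>m\<close>
        always keeps a positive coefficient.\<close>
      define \<theta> where "\<theta> = (k - k0) / (k1 - k0)"
      have \<theta>: "0 \<le> \<theta>" "\<theta> < 1"
        using m(2,3) by (auto simp: \<theta>_def k0_def k1_def field_simps)
      have "\<theta> * (k1 - k0) = k - k0"
        using m(2,3) by (simp add: \<theta>_def k0_def k1_def)
      then have k: "k = (1 - \<theta>) * k0 + \<theta> * k1" by (simp add: algebra_simps)
      define t where "t = (1 - \<theta>) * b0 + \<theta> * b1 - b"
      have "t \<ge> 0"
      proof -
        define x y where "x = ratio_x (Suc m)" and "y = ratio_y (Suc m)"
        have b01: "b0 = y - k0 * x" "b1 = y - k1 * x" and le: "k * x + b \<le> y"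
          using line_through_ratios(2)[OF m(1)] line_through_ratios(1)[of "Suc m"] below[of "Suc m"]
          by (auto simp: k0_def k1_def b0_def b1_def x_def y_def)
        then have "t = y - (k * x + b)"
          unfolding t_def k b01 by (simp add: algebra_simps)
        then show ?thesis using le by simp
      qed
      have "v = (s * (1 - \<theta>)) *\<^sub>R vector [k0, b0, - 1]
          + ((s * \<theta>) *\<^sub>R vector [k1, b1, - 1] + (s * t) *\<^sub>R vector [0, - 1, 0])"
        unfolding v_s k t_def by (simp add: vec_eq_iff forall_3 algebra_simps)
      moreover have "(s * \<theta>) *\<^sub>R vector [k1, b1, - 1] + (s * t) *\<^sub>R vector [0, - 1, 0] \<in> chern_cone"
        using \<theta> \<open>s > 0\<close> \<open>t \<ge> 0\<close> edge_vectors_intros(2)[of "Suc m"] edge_vectors_subset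
        by (intro chern_cone_add chern_cone_scale horizontal_members) (auto simp: k1_def b1_def)
      ultimately show ?thesis
        using \<theta> \<open>s > 0\<close> edge_vectors_intros(2)[OF m(1)]
        by (intro has_edge_componentI) (auto simp: k0_def b0_def)
    qed
  qed
qed

lemma edge_of_chern_cone_iff:
  "E edge_of chern_cone \<longleftrightarrow> (\<exists>u\<in>edge_vectors. E = cone hull {u})"
proof
  assume E: "E edge_of chern_cone"
  then have face: "E face_of chern_cone" and "aff_dim E = 1"
    by (auto simp: edge_of_def)
  have "\<not> E \<subseteq> {0}"
    using aff_dim_subset[of E "{0}"] \<open>aff_dim E = 1\<close> by auto
  then obtain v where v: "v \<in> E" "v \<noteq> 0" by blast
  then have "v \<in> chern_cone" using face face_of_imp_subset by blast
  then obtain u a where u: "u \<in> edge_vectors" "a > 0" "v - a *\<^sub>R u \<in> chern_cone"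
    using chern_cone_has_edge_component[OF _ v(2)] unfolding has_edge_component_def by blast
  have "u \<in> chern_cone" using u(1) edge_vectors_subset by blast
  then have "a *\<^sub>R u \<in> E"
    using face_of_cone_summand[OF cone_chern_cone face _ u(3)] u(2) v(1) by (simp add: chern_cone_scale)
  moreover have "a *\<^sub>R u \<noteq> 0" using u(2) edge_of_chern_cone(2)[OF u(1)] by simp
  ultimately have E_eq: "E = cone hull {a *\<^sub>R u}"
    using edge_of_cone_eq_ray[OF cone_chern_cone pointed_chern_cone E] by blast
  have "(1 / a) *\<^sub>R a *\<^sub>R u \<in> E"
    unfolding E_eq by (rule mem_cone[OF cone_cone_hull hull_inc]) (use u(2) in auto)
  then have "u \<in> E" using u(2) by simp
  then show "\<exists>u\<in>edge_vectors. E = cone hull {u}"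
    using edge_of_cone_eq_ray[OF cone_chern_cone pointed_chern_cone E] u(1) edge_of_chern_cone(2) by blast
qed (auto intro: edge_of_chern_cone)

lemma edge_vectors_rational:
  assumes "u \<in> edge_vectors"
  shows "u $ i \<in> \<rat>"
proof -
  have "line_slope m \<in> \<rat>" "line_intercept m \<in> \<rat>" for m
    by (auto simp: line_slope_def line_intercept_def)
  then have "u $ 1 \<in> \<rat> \<and> u $ 2 \<in> \<rat> \<and> u $ 3 \<in> \<rat>"
    using assms by (auto simp: edge_vectors_def limit_slope_def limit_intercept_def)
  then show ?thesis using exhaust_3[of i] by auto
qed

theorem theorem1p4:
  shows "cone chern_cone \<and> convex chern_cone \<and>
    (\<forall>E. E edge_of chern_cone \<longrightarrow>
       (\<exists>v. v \<noteq> 0 \<and> (\<forall>i. v $ i \<in> \<rat>) \<and> E = cone hull {v})) \<and>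
    {E. E edge_of chern_cone} = {cone hull {v} | v. v \<in> edge_vectors}"
  using cone_chern_cone convex_chern_cone edge_of_chern_cone(2) edge_vectors_rational
  unfolding edge_of_chern_cone_iff by blast

end
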